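(* Let $X_1,\dots,X_n$ be i.i.d. real random variables with density $f(x;\theta_0)$ belonging to a full-rank one-parameter exponential family $f(x;\theta)=\exp\{\theta b(x)-A(\theta)\}$, $\theta\in\Theta\subseteq\mathbb R$. Let $\alpha(x;\theta)=1-P_\theta(X\le x)$, assumed to satisfy $\alpha(x;\theta)>0$ for all $x$, and let $x_n$ be a sequence with $x_n\to\infty$ as $n\to\infty$. Suppose that (A.1) $q_n>0$ is a sequence with $q_n\to1$, and (A.2) $\Theta$ is compact and $\theta_0$ is an interior point of $\Theta$. Let $\theta_n^*=\theta_0/q_n$ and let $\widetilde\theta_n$ be the maximum L$q$-likelihood estimator of $\theta_0$ with $q=q_n$. If $$n^{-1/2}\,|\gamma(x_n;\theta_n^* )|\,\beta(x_n;\theta_n^*;\delta)\to0\quad\text{as }n\to\infty\text{ for each }\delta>0,$$ then $$\sqrt n\,\frac{\alpha(x_n;\widetilde\theta_n)-\alpha(x_n;\theta_n^* )}{\sigma_n\,\alpha'(x_n;\theta_n^* )}\xrightarrow{\ \mathscr D\ }N(0,1),$$ where $\sigma_n=-\big[E_{\theta_0}U^*(X;\theta_n^*,q_n)^2\big]^{1/2}\Big/E_{\theta_0}\Big[\tfrac{\partial}{\partial\theta}U^*(X;\theta,q_n)\big|_{\theta=\theta_n^*}\Big]$.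
   Context: Exponential family: densities are with respect to a $\sigma$-finite measure $\mu$, and $A(\theta)=\log\int e^{\theta b(x)}\,d\mu(x)$ is finite on $\Theta$; full rank means $b$ is not $\mu$-a.e. constant. $P_\theta$, $E_\theta$ denote probability and expectation when $X$ has density $f(\cdot;\theta)$. For $u>0$, $L_q(u)=\log u$ if $q=1$ and $L_q(u)=(u^{1-q}-1)/(1-q)$ if $q\neq1$ ($q>0$). The maximum L$q$-likelihood estimator is $\widetilde\theta_n=\arg\max_{\theta\in\Theta}\sum_{i=1}^nL_{q_n}[f(X_i;\theta)]$. Modified score: $U^*(x;\theta,q)=f(x;\theta)^{1-q}\,\frac{\partial}{\partial\theta}\log f(x;\theta)$. The surrogate parameter $\theta_n^*=\theta_0/q_n$ is the value satisfying $E_{\theta_0}U^*(X;\theta_n^*,q_n)=0$. Primes denote derivatives with respect to $\theta$: $\alpha'(x;\theta)=\partial\alpha/\partial\theta$, $\alpha''(x;\theta)=\partial^2\alpha/\partial\theta^2$. For $\theta^*\in\Theta$ and $\delta>0$, $$\beta(x;\theta^*;\delta)=\sup_{\theta\in\Theta\cap[\theta^*-\delta/\sqrt n,\ \theta^*+\delta/\sqrt n]}\left|\frac{\alpha''(x;\theta)}{\alpha''(x;\theta^* )}\right|,\qquad\gamma(x;\theta)=\frac{\alpha''(x;\theta)}{\alpha'(x;\theta)}$$ ($\beta$ depends on $n$; the denominators are implicitly assumed nonzero at the points used). *)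

theory Defs
  imports "HOL-Probability.Probability"
begin

definition log_partition :: "real measure \<Rightarrow> (real \<Rightarrow> real) \<Rightarrow> real \<Rightarrow> real" where
  "log_partition \<mu> b \<theta> = ln (LINT x|\<mu>. exp (\<theta> * b x))"

definition ef_density :: "real measure \<Rightarrow> (real \<Rightarrow> real) \<Rightarrow> real \<Rightarrow> real \<Rightarrow> real" where
  "ef_density \<mu> b x \<theta> = exp (\<theta> * b x - log_partition \<mu> b \<theta>)"

text \<open>The law \<open>P\<^sub>\<theta>\<close>; \<open>E\<^sub>\<theta>\<close> is the Lebesgue integral with respect to it.\<close>

definition ef_law :: "real measure \<Rightarrow> (real \<Rightarrow> real) \<Rightarrow> real \<Rightarrow> real measure" where
  "ef_law \<mu> b \<theta> = density \<mu> (\<lambda>x. ennreal (ef_density \<mu> b x \<theta>))"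

text \<open>Integrability of \<open>exp (\<theta> * b x)\<close> says that \<open>log_partition \<mu> b \<theta>\<close> is finite: the full-rank
  condition excludes the null measure, so the integral is also positive.\<close>

definition full_rank_exp_family :: "real measure \<Rightarrow> (real \<Rightarrow> real) \<Rightarrow> real set \<Rightarrow> bool" where
  "full_rank_exp_family \<mu> b \<Theta> \<longleftrightarrow>
     sigma_finite_measure \<mu> \<and> sets \<mu> = sets borel \<and> b \<in> borel_measurable \<mu> \<and>
     (\<forall>\<theta>\<in>\<Theta>. integrable \<mu> (\<lambda>x. exp (\<theta> * b x))) \<and>
     \<not> (\<exists>c. AE x in \<mu>. b x = c)"

definition Lq :: "real \<Rightarrow> real \<Rightarrow> real" where
  "Lq q u = (if q = 1 then ln u else (u powr (1 - q) - 1) / (1 - q))"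

definition Ustar :: "real measure \<Rightarrow> (real \<Rightarrow> real) \<Rightarrow> real \<Rightarrow> real \<Rightarrow> real \<Rightarrow> real" where
  "Ustar \<mu> b x \<theta> q =
     ef_density \<mu> b x \<theta> powr (1 - q) * deriv (\<lambda>t. ln (ef_density \<mu> b x t)) \<theta>"

text \<open>Maximisers need not be unique when \<open>q \<noteq> 1\<close>, so the maximum Lq-likelihood estimator is any
  maximiser (for each sample size \<open>n\<close> and sample \<open>x 1, \<dots>, x n\<close>).\<close>

definition is_MLqE ::
  "real measure \<Rightarrow> (real \<Rightarrow> real) \<Rightarrow> real set \<Rightarrow> real \<Rightarrow> nat \<Rightarrow> (nat \<Rightarrow> real) \<Rightarrow> real \<Rightarrow> bool" where
  "is_MLqE \<mu> b \<Theta> q n x \<theta> \<longleftrightarrow>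
     is_arg_max (\<lambda>t. \<Sum>i=1..n. Lq q (ef_density \<mu> b (x i) t)) (\<lambda>t. t \<in> \<Theta>) \<theta>"

definition tail :: "real measure \<Rightarrow> (real \<Rightarrow> real) \<Rightarrow> real \<Rightarrow> real \<Rightarrow> real" where
  "tail \<mu> b x \<theta> = 1 - measure (ef_law \<mu> b \<theta>) {..x}"

definition tail_d1 :: "real measure \<Rightarrow> (real \<Rightarrow> real) \<Rightarrow> real \<Rightarrow> real \<Rightarrow> real" where
  "tail_d1 \<mu> b x \<theta> = deriv (\<lambda>t. tail \<mu> b x t) \<theta>"

definition tail_d2 :: "real measure \<Rightarrow> (real \<Rightarrow> real) \<Rightarrow> real \<Rightarrow> real \<Rightarrow> real" where
  "tail_d2 \<mu> b x \<theta> = deriv (\<lambda>t. tail_d1 \<mu> b x t) \<theta>"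

text \<open>The supremum is a real one. Once the interval lies in the interior of \<open>\<Theta>\<close>
  (all large \<open>n\<close>, if \<open>\<theta>s\<close> tends to an interior point), \<open>tail_d2 \<mu> b x\<close> is continuous on it,
  so the set of values is bounded.\<close>

definition tail_beta ::
  "real measure \<Rightarrow> (real \<Rightarrow> real) \<Rightarrow> real set \<Rightarrow> nat \<Rightarrow> real \<Rightarrow> real \<Rightarrow> real \<Rightarrow> real" where
  "tail_beta \<mu> b \<Theta> n x \<theta>s \<delta> =
     (SUP \<theta>\<in>\<Theta> \<inter> {\<theta>s - \<delta> / sqrt (real n) .. \<theta>s + \<delta> / sqrt (real n)}.
        \<bar>tail_d2 \<mu> b x \<theta> / tail_d2 \<mu> b x \<theta>s\<bar>)"

definition tail_gamma :: "real measure \<Rightarrow> (real \<Rightarrow> real) \<Rightarrow> real \<Rightarrow> real \<Rightarrow> real" where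
  "tail_gamma \<mu> b x \<theta> = tail_d2 \<mu> b x \<theta> / tail_d1 \<mu> b x \<theta>"

definition sigma_MLqE ::
  "real measure \<Rightarrow> (real \<Rightarrow> real) \<Rightarrow> real \<Rightarrow> real \<Rightarrow> real \<Rightarrow> real" where
  "sigma_MLqE \<mu> b \<theta>0 \<theta>s q =
     - sqrt (LINT x|ef_law \<mu> b \<theta>0. (Ustar \<mu> b x \<theta>s q)\<^sup>2) /
       (LINT x|ef_law \<mu> b \<theta>0. deriv (\<lambda>\<theta>. Ustar \<mu> b x \<theta> q) \<theta>s)"

end

theory Submission
  imports Defs
begin

text \<open>
  With \<open>Y\<^sub>i = b (X\<^sub>i)\<close> and \<open>\<epsilon>\<^sub>n = 1 - q\<^sub>n\<close>, the Lq-likelihood depends on the sample only through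
  the \<open>Y\<^sub>i\<close>, which are i.i.d. with all moments and with exponential moments near \<open>0\<close>,
  because \<open>\<theta>0\<close> is interior. Up to a positive factor the estimating equation is
  \<open>\<phi>\<^sub>n t = (1/n) \<Sum> exp (\<epsilon>\<^sub>n t Y\<^sub>i) (Y\<^sub>i - A' t) = 0\<close>, a small perturbation of the likelihood equation of
  the exponential family, and the proof compares it with its limit as \<open>\<epsilon>\<^sub>n\<close> tends to \<open>0\<close>.

  Consistency (\<open>estimator_consistent\<close>): the averaged Lq-likelihood differs from the averaged
  log-likelihood \<open>t (\<Sum> Y\<^sub>i)/n - A t\<close> by at most \<open>\<bar>\<epsilon>\<^sub>n\<bar>\<close> times the average of an integrable function
  of \<open>Y\<^sub>i\<close>, uniformly over \<open>\<Theta>\<close> and for all large \<open>n\<close>. The limit \<open>t E Y - A t\<close> of the latter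
  has a well separated maximum at \<open>\<theta>0\<close>: the deficit is a Kullback-Leibler divergence, which is
  monotone on either side of \<open>\<theta>0\<close> and positive away from it (\<open>excess_mono\<close>, \<open>excess_pos\<close>).

  Asymptotic linearity (\<open>estimator_asymptotically_linear\<close>): with probability tending to \<open>1\<close> the
  estimator is an interior maximiser, hence a zero of \<open>\<phi>\<^sub>n\<close>, and the mean value theorem gives
  \<open>\<phi>\<^sub>n (\<theta>0 / q\<^sub>n) = \<Lambda>\<^sub>n (\<theta>t\<^sub>n - \<theta>0 / q\<^sub>n)\<close> with \<open>\<Lambda>\<^sub>n\<close> tending to \<open>A'' \<theta>0 = Var Y\<close>. The surrogate parameter is
  chosen so that \<open>\<phi>\<^sub>n (\<theta>0 / q\<^sub>n)\<close> has mean zero. Its summands therefore differ from the centred \<open>Y\<^sub>i\<close>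
  by centred variables of vanishing variance, so that Chebyshev's inequality replaces a central
  limit theorem for triangular arrays: \<open>\<surd>n (\<theta>t\<^sub>n - \<theta>0 / q\<^sub>n) / \<sigma>\<^sub>n\<close> is the standardised sum of the
  \<open>Y\<^sub>i\<close> up to a term that vanishes in probability, since \<open>\<sigma>\<^sub>n\<close> tends to \<open>1 / \<surd>(Var Y)\<close>.

  Delta method (\<open>delta_method\<close>): a Taylor expansion of order two of \<open>\<alpha> (x\<^sub>n; \<cdot>)\<close> at \<open>\<theta>0 / q\<^sub>n\<close> has a
  remainder which, relative to \<open>\<sigma>\<^sub>n \<alpha>'/\<surd>n\<close> and on the event that the estimator lies within
  \<open>\<delta> / \<surd>n\<close>, is at most a constant times \<open>n\<^sup>-\<^sup>1\<^sup>/\<^sup>2 \<bar>\<gamma>\<bar> \<beta>\<close>. Tightness allows \<open>\<delta>\<close> to be fixed first.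
  The classical central limit theorem and Slutsky's lemma conclude.
\<close>

section \<open>Moments under exponential weights\<close>

lemma power_le_exp:
  fixes y \<eta> :: real
  assumes "0 < \<eta>" "0 \<le> y"
  shows "y ^ k \<le> fact k / \<eta> ^ k * exp (\<eta> * y)"
proof -
  have "(\<eta> * y) ^ k /\<^sub>R fact k \<le> exp (\<eta> * y)"
    using sum_le_suminf[OF summable_exp_generic[of "\<eta> * y"], of "{k}"] assms
    by (simp add: exp_def)
  then show ?thesis
    using assms by (simp add: field_simps power_mult_distrib)
qed

lemma exp_bounds:
  fixes z :: real
  shows abs_exp_minus_1_le: "\<bar>exp z - 1\<bar> \<le> \<bar>z\<bar> * exp \<bar>z\<bar>"
    and abs_exp_minus_linear_le: "\<bar>exp z - 1 - z\<bar> \<le> z\<^sup>2 * exp \<bar>z\<bar>"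
proof -
  have *: "\<bar>exp z - 1\<bar> \<le> \<bar>z\<bar> * exp \<bar>z\<bar>" for z :: real
  proof (cases "z \<ge> 0")
    case True
    have "exp z * (1 - z) \<le> exp z * exp (- z)"
      using exp_ge_add_one_self[of "-z"] by (intro mult_left_mono) auto
    then show ?thesis using True by (simp add: exp_minus field_simps)
  next
    case False
    have "1 - exp z \<le> -z * 1" using exp_ge_add_one_self[of z] by linarith
    also have "\<dots> \<le> -z * exp (-z)" using False by (intro mult_left_mono) auto
    finally show ?thesis using False by simp
  qed
  show "\<bar>exp z - 1\<bar> \<le> \<bar>z\<bar> * exp \<bar>z\<bar>" by (rule *)
  \<comment> \<open>By convexity \<open>0 \<le> exp z - 1 - z \<le> z * (exp z - 1)\<close>.\<close>
  have "exp z * (1 - z) \<le> exp z * exp (- z)"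
    using exp_ge_add_one_self[of "-z"] by (intro mult_left_mono) auto
  then have "exp z - 1 - z \<le> z * (exp z - 1)" by (simp add: exp_minus field_simps)
  moreover have "z * (exp z - 1) \<le> \<bar>z\<bar> * (\<bar>z\<bar> * exp \<bar>z\<bar>)"
  proof -
    have "z * (exp z - 1) \<le> \<bar>z * (exp z - 1)\<bar>" by simp
    also have "\<dots> \<le> \<bar>z\<bar> * (\<bar>z\<bar> * exp \<bar>z\<bar>)"
      unfolding abs_mult by (intro mult_left_mono *) auto
    finally show ?thesis .
  qed
  moreover have "0 \<le> exp z - 1 - z" using exp_ge_add_one_self[of z] by linarith
  ultimately show "\<bar>exp z - 1 - z\<bar> \<le> z\<^sup>2 * exp \<bar>z\<bar>"
    by (simp add: power2_eq_square mult.assoc)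
qed

text \<open>
  The convex function \<open>z \<mapsto> exp z - z\<close> has its minimum at \<open>0\<close>, so it grows along every ray.
\<close>

lemma exp_minus_linear_mono:
  fixes r s y :: real
  assumes "0 \<le> r" "r \<le> s"
  shows "exp (r * y) - r * y \<le> exp (s * y) - s * y"
proof -
  have "exp (s * y) = exp (r * y) * exp ((s - r) * y)"
    by (simp add: exp_add[symmetric] algebra_simps)
  also have "\<dots> \<ge> exp (r * y) * (1 + (s - r) * y)"
    using exp_ge_add_one_self[of "(s-r)*y"] by (intro mult_left_mono) auto
  finally have "exp (s * y) \<ge> exp (r * y) + (s - r) * (exp (r * y) * y)"
    by (simp add: algebra_simps)
  moreover have "exp (r * y) * y \<ge> y"
  proof (cases "y \<ge> 0")
    case True then show ?thesis using assms by (simp add: mult_le_cancel_right1)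
  next
    case False
    then have "exp (r * y) \<le> 1" using assms by (simp add: mult_nonneg_nonpos)
    then show ?thesis using False by (simp add: mult_le_cancel_right2)
  qed
  then have "(s - r) * (exp (r * y) * y) \<ge> (s - r) * y"
    using assms by (intro mult_left_mono) auto
  ultimately show ?thesis by (simp add: algebra_simps)
qed

text \<open>
  The weight \<open>w\<close> allows the normalising constant (\<open>w = 1\<close>) and the mass of a half-line (\<open>w\<close> its
  indicator) to be differentiated in \<open>t\<close> by one argument.
\<close>

definition exp_moment :: "'a measure \<Rightarrow> ('a \<Rightarrow> real) \<Rightarrow> ('a \<Rightarrow> real) \<Rightarrow> nat \<Rightarrow> real \<Rightarrow> real" where
  "exp_moment \<mu> w b k t = (LINT x|\<mu>. w x * b x ^ k * exp (t * b x))"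

text \<open>
  A polynomial in \<open>\<bar>b\<bar>\<close> is dominated by \<open>exp (\<eta> \<bar>b\<bar>)\<close> for every \<open>\<eta> > 0\<close>, and
  \<open>exp (t b + s \<bar>b\<bar>)\<close> by the sum of the exponentials at the two parameters \<open>t \<plusminus> s\<close>.
\<close>

lemma integrable_exp_envelope:
  fixes b :: "'a \<Rightarrow> real"
  assumes [measurable]: "b \<in> borel_measurable \<mu>"
    and int: "\<And>s. \<bar>s - t\<bar> < r \<Longrightarrow> integrable \<mu> (\<lambda>x. exp (s * b x))"
    and "0 \<le> \<kappa>" "\<kappa> < r"
  shows "integrable \<mu> (\<lambda>x. (1 + \<bar>b x\<bar>) ^ k * exp (t * b x + \<kappa> * \<bar>b x\<bar>))"
proof -
  \<comment> \<open>Half of the room left in the interval pays for the polynomial factor.\<close>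
  define \<eta> where "\<eta> = (r - \<kappa>) / 2"
  have \<eta>: "0 < \<eta>" "\<kappa> + \<eta> < r" using assms by (auto simp: \<eta>_def field_simps)
  let ?s = "\<kappa> + \<eta>"
  let ?C = "fact k / \<eta> ^ k * exp \<eta>"
  have "integrable \<mu> (\<lambda>x. ?C * (exp ((t + ?s) * b x) + exp ((t - ?s) * b x)))"
    using \<eta> assms(3) by (intro integrable_mult_right Bochner_Integration.integrable_add int) auto
  then show ?thesis
  proof (rule Bochner_Integration.integrable_bound)
    show "AE x in \<mu>. norm ((1 + \<bar>b x\<bar>) ^ k * exp (t * b x + \<kappa> * \<bar>b x\<bar>))
        \<le> norm (?C * (exp ((t + ?s) * b x) + exp ((t - ?s) * b x)))"
    proof (rule AE_I2)
      fix x
      have "(1 + \<bar>b x\<bar>) ^ k * exp (t * b x + \<kappa> * \<bar>b x\<bar>) \<le>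
          (fact k / \<eta> ^ k * exp (\<eta> * (1 + \<bar>b x\<bar>))) * exp (t * b x + \<kappa> * \<bar>b x\<bar>)"
        using \<eta> by (intro mult_right_mono power_le_exp) auto
      also have "\<dots> = ?C * exp (t * b x + ?s * \<bar>b x\<bar>)"
        by (simp add: exp_add[symmetric] algebra_simps)
      also have "\<dots> \<le> ?C * (exp ((t + ?s) * b x) + exp ((t - ?s) * b x))"
      proof (rule mult_left_mono)
        show "exp (t * b x + ?s * \<bar>b x\<bar>) \<le> exp ((t + ?s) * b x) + exp ((t - ?s) * b x)"
          by (cases "b x \<ge> 0") (simp_all add: algebra_simps)
      qed (use \<eta> in simp)
      finally have "(1 + \<bar>b x\<bar>) ^ k * exp (t * b x + \<kappa> * \<bar>b x\<bar>) \<le>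
          ?C * (exp ((t + ?s) * b x) + exp ((t - ?s) * b x))" .
      then show "norm ((1 + \<bar>b x\<bar>) ^ k * exp (t * b x + \<kappa> * \<bar>b x\<bar>))
        \<le> norm (?C * (exp ((t + ?s) * b x) + exp ((t - ?s) * b x)))"
        using \<eta> by (simp add: abs_mult add_nonneg_nonneg abs_of_nonneg)
    qed
  qed auto
qed

locale exp_moments =
  fixes \<mu> :: "'a measure" and b w :: "'a \<Rightarrow> real" and \<theta>0 \<rho> :: real
  assumes b_meas [measurable]: "b \<in> borel_measurable \<mu>"
    and w_meas [measurable]: "w \<in> borel_measurable \<mu>"
    and w_le: "\<And>x. \<bar>w x\<bar> \<le> 1"
    and exp_integrable: "\<And>t. \<bar>t - \<theta>0\<bar> < \<rho> \<Longrightarrow> integrable \<mu> (\<lambda>x. exp (t * b x))"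
begin

lemma integrable_envelope:
  assumes "\<bar>t - \<theta>0\<bar> + \<kappa> < \<rho>" "0 \<le> \<kappa>"
  shows "integrable \<mu> (\<lambda>x. (1 + \<bar>b x\<bar>) ^ k * exp (t * b x + \<kappa> * \<bar>b x\<bar>))"
  by (rule integrable_exp_envelope[where r = "\<rho> - \<bar>t - \<theta>0\<bar>"])
    (use assms in \<open>auto intro!: exp_integrable\<close>)

lemma integrable_moment:
  assumes "\<bar>t - \<theta>0\<bar> < \<rho>"
  shows "integrable \<mu> (\<lambda>x. w x * b x ^ k * exp (t * b x))"
proof (rule Bochner_Integration.integrable_bound[OF integrable_envelope[of t 0 k]])
  show "AE x in \<mu>. norm (w x * b x ^ k * exp (t * b x))
      \<le> norm ((1 + \<bar>b x\<bar>) ^ k * exp (t * b x + 0 * \<bar>b x\<bar>))"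
  proof (rule AE_I2)
    fix x
    have "\<bar>w x\<bar> * \<bar>b x\<bar> ^ k * exp (t * b x) \<le> 1 * (1 + \<bar>b x\<bar>) ^ k * exp (t * b x)"
      by (intro mult_mono power_mono w_le) auto
    then show "norm (w x * b x ^ k * exp (t * b x))
      \<le> norm ((1 + \<bar>b x\<bar>) ^ k * exp (t * b x + 0 * \<bar>b x\<bar>))"
      by (simp add: abs_mult power_abs abs_of_nonneg)
  qed
qed (use assms in auto)

text \<open>
  Differentiation under the integral sign. The second-order error of the exponential,
  \<open>h\<^sup>2 b\<^sup>2 exp \<bar>h b\<bar>\<close>, is integrable against the weights, so the difference quotient converges at rate \<open>\<bar>h\<bar>\<close>.
\<close>

lemma DERIV_exp_moment:
  assumes t: "\<bar>t - \<theta>0\<bar> < \<rho>"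
  shows "(exp_moment \<mu> w b k has_real_derivative exp_moment \<mu> w b (Suc k) t) (at t)"
proof -
  define \<eta> where "\<eta> = (\<rho> - \<bar>t - \<theta>0\<bar>) / 2"
  have \<eta>: "0 < \<eta>" "\<bar>t - \<theta>0\<bar> + \<eta> < \<rho>" using t by (auto simp: \<eta>_def field_simps)
  let ?F = "exp_moment \<mu> w b"
  define g where "g x = (1 + \<bar>b x\<bar>) ^ (k + 2) * exp (t * b x + \<eta> * \<bar>b x\<bar>)" for x
  have g: "integrable \<mu> g" unfolding g_def using integrable_envelope[of t \<eta> "k + 2"] \<eta> by simp
  have bound: "\<bar>(?F k (t + h) - ?F k t) / h - ?F (Suc k) t\<bar> \<le> \<bar>h\<bar> * (LINT x|\<mu>. g x)"
    if h: "h \<noteq> 0" "\<bar>h\<bar> < \<eta>" for h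
  proof -
    let ?R = "\<lambda>x. w x * b x ^ k * exp ((t + h) * b x) - w x * b x ^ k * exp (t * b x)
      - h * (w x * b x ^ Suc k * exp (t * b x))"
    have i1: "integrable \<mu> (\<lambda>x. w x * b x ^ k * exp ((t + h) * b x))"
      and i2: "integrable \<mu> (\<lambda>x. w x * b x ^ k * exp (t * b x))"
      and i3: "integrable \<mu> (\<lambda>x. w x * b x ^ Suc k * exp (t * b x))"
      using t h \<eta> by (intro integrable_moment; linarith)+
    have iR: "integrable \<mu> ?R"
      by (intro Bochner_Integration.integrable_diff integrable_mult_right i1 i2 i3)
    have eq: "?F k (t + h) - ?F k t - h * ?F (Suc k) t = (LINT x|\<mu>. ?R x)"
      unfolding exp_moment_def
      by (simp only: Bochner_Integration.integral_diff[OF Bochner_Integration.integrable_diff[OF i1 i2] integrable_mult_right[OF i3]]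
          Bochner_Integration.integral_diff[OF i1 i2] integral_mult_right_zero)
    have R: "\<bar>?R x\<bar> \<le> h\<^sup>2 * g x" for x
    proof -
      have "?R x = w x * b x ^ k * exp (t * b x) * (exp (h * b x) - 1 - h * b x)"
        by (simp add: exp_add ring_distribs algebra_simps)
      then have "\<bar>?R x\<bar> = \<bar>w x\<bar> * (\<bar>b x\<bar> ^ k * exp (t * b x) * \<bar>exp (h * b x) - 1 - h * b x\<bar>)"
        by (simp add: abs_mult power_abs)
      also have "\<dots> \<le> 1 * (\<bar>b x\<bar> ^ k * exp (t * b x) * ((h * b x)\<^sup>2 * exp \<bar>h * b x\<bar>))"
        using w_le[of x] by (intro mult_mono abs_exp_minus_linear_le) auto
      also have "\<dots> = h\<^sup>2 * (\<bar>b x\<bar> ^ (k + 2) * exp (t * b x + \<bar>h\<bar> * \<bar>b x\<bar>))"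
        by (simp add: exp_add power_mult_distrib power_add abs_mult power2_eq_square algebra_simps)
      also have "\<dots> \<le> h\<^sup>2 * g x"
        unfolding g_def using h
        by (intro mult_left_mono mult_mono power_mono iffD2[OF exp_le_cancel_iff] add_left_mono mult_right_mono) auto
      finally show ?thesis .
    qed
    have "\<bar>LINT x|\<mu>. ?R x\<bar> \<le> (LINT x|\<mu>. \<bar>?R x\<bar>)" by (rule integral_abs_bound)
    also have "\<dots> \<le> (LINT x|\<mu>. h\<^sup>2 * g x)"
      by (intro integral_mono integrable_abs iR integrable_mult_right g R)
    finally have "\<bar>?F k (t + h) - ?F k t - h * ?F (Suc k) t\<bar> \<le> h\<^sup>2 * (LINT x|\<mu>. g x)"
      unfolding eq by simp
    moreover have "(?F k (t + h) - ?F k t) / h - ?F (Suc k) t = (?F k (t + h) - ?F k t - h * ?F (Suc k) t) / h"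
      using h by (simp add: field_simps)
    ultimately show ?thesis
      using h by (simp add: abs_divide divide_le_eq power2_eq_square mult.assoc[symmetric])
        (simp add: mult_ac)
  qed
  have lim: "((\<lambda>h. \<bar>h\<bar> * (LINT x|\<mu>. g x)) \<longlongrightarrow> 0) (at 0)"
    by (auto intro!: tendsto_eq_intros)
  have "eventually (\<lambda>h. h \<noteq> 0 \<and> \<bar>h\<bar> < \<eta>) (at 0)"
    using \<eta>(1) by (auto simp: eventually_at dist_real_def)
  then have "((\<lambda>h. (?F k (t + h) - ?F k t) / h - ?F (Suc k) t) \<longlongrightarrow> 0) (at 0)"
    by (intro Lim_null_comparison[OF _ lim]) (auto elim!: eventually_mono intro: bound)
  then show ?thesis
    unfolding DERIV_def by (subst (asm) LIM_zero_iff)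
qed

lemma isCont_exp_moment:
  "\<bar>t - \<theta>0\<bar> < \<rho> \<Longrightarrow> isCont (exp_moment \<mu> w b k) t"
  using DERIV_isCont[OF DERIV_exp_moment] .

end

section \<open>Convergence in probability as a filter\<close>

lemma norm_iexp_diff_le:
  fixes a b :: real
  shows "norm (iexp a - iexp b) \<le> \<bar>a - b\<bar>" "norm (iexp a - iexp b) \<le> 2"
proof -
  have "iexp a - iexp b = iexp b * (iexp (a - b) - 1)"
    by (simp add: algebra_simps exp_add[symmetric])
  then have "norm (iexp a - iexp b) = norm (iexp (a - b) - 1)"
    by (simp add: norm_mult)
  also have "\<dots> \<le> \<bar>a - b\<bar>" using iexp_approx1[of "a - b" 0] by simp
  finally show "norm (iexp a - iexp b) \<le> \<bar>a - b\<bar>" .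
  show "norm (iexp a - iexp b) \<le> 2"
    using norm_triangle_ineq4[of "iexp a" "iexp b"] by simp
qed

text \<open>
  A property holds eventually along this filter iff, for every \<open>d > 0\<close> and all large \<open>n\<close>, the points
  \<open>\<omega>\<close> where it fails at \<open>(n, \<omega>)\<close> are covered by a measurable set of probability at most \<open>d\<close>.
  Convergence in probability of \<open>Z\<close> to \<open>c\<close> is then
  \<open>((\<lambda>p. Z (fst p) (snd p)) \<longlongrightarrow> c) (in_prob M)\<close>, and the calculus of limits along a filter (sums,
  quotients, continuous images) applies. Covering by measurable sets makes sense also for quantities that
  are not measurable, such as an intermediate point in a mean value theorem.
\<close>

definition in_prob :: "'a measure \<Rightarrow> (nat \<times> 'a) filter" where
  "in_prob M = Abs_filter (\<lambda>P. \<forall>d>0. \<forall>\<^sub>F n in sequentially.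
     \<exists>E\<in>sets M. measure M E \<le> d \<and> (\<forall>\<omega>\<in>space M - E. P (n, \<omega>)))"

definition tight_rvs :: "'a measure \<Rightarrow> (nat \<Rightarrow> 'a \<Rightarrow> real) \<Rightarrow> bool" where
  "tight_rvs M Z \<longleftrightarrow> (\<forall>d>0. \<exists>B>0. \<forall>\<^sub>F n in sequentially.
     \<exists>E\<in>sets M. measure M E \<le> d \<and> (\<forall>\<omega>\<in>space M - E. \<bar>Z n \<omega>\<bar> \<le> B))"

context prob_space
begin

lemma eventually_in_prob:
  "eventually P (in_prob M) \<longleftrightarrow> (\<forall>d>0. \<forall>\<^sub>F n in sequentially.
     \<exists>E\<in>sets M. prob E \<le> d \<and> (\<forall>\<omega>\<in>space M - E. P (n, \<omega>)))"
  unfolding in_prob_def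
proof (rule eventually_Abs_filter, rule is_filter.intro, goal_cases)
  case 1
  show ?case by (auto intro!: always_eventually bexI[of _ "{}"])
next
  case (2 P Q)
  show ?case
  proof (intro allI impI)
    fix d :: real assume "d > 0"
    then have "d / 2 > 0" by simp
    with 2 have "\<forall>\<^sub>F n in sequentially.
        (\<exists>E\<in>sets M. prob E \<le> d / 2 \<and> (\<forall>\<omega>\<in>space M - E. P (n, \<omega>))) \<and>
        (\<exists>E\<in>sets M. prob E \<le> d / 2 \<and> (\<forall>\<omega>\<in>space M - E. Q (n, \<omega>)))"
      by (intro eventually_conj) blast+
    then show "\<forall>\<^sub>F n in sequentially. \<exists>E\<in>sets M. prob E \<le> d \<and> (\<forall>\<omega>\<in>space M - E. P (n, \<omega>) \<and> Q (n, \<omega>))"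
    proof eventually_elim
      case (elim n)
      then obtain E F where EF: "E \<in> sets M" "prob E \<le> d / 2" "\<forall>\<omega>\<in>space M - E. P (n, \<omega>)"
        "F \<in> sets M" "prob F \<le> d / 2" "\<forall>\<omega>\<in>space M - F. Q (n, \<omega>)" by blast
      have "prob (E \<union> F) \<le> d"
        using measure_Un_le[OF EF(1,4)] EF(2,5) by linarith
      with EF show ?case by (intro bexI[of _ "E \<union> F"]) auto
    qed
  qed
next
  case (3 P Q)
  show ?case
  proof (intro allI impI)
    fix d :: real assume "d > 0"
    with 3(2) have "\<forall>\<^sub>F n in sequentially. \<exists>E\<in>sets M. prob E \<le> d \<and> (\<forall>\<omega>\<in>space M - E. P (n, \<omega>))" by blast
    then show "\<forall>\<^sub>F n in sequentially. \<exists>E\<in>sets M. prob E \<le> d \<and> (\<forall>\<omega>\<in>space M - E. Q (n, \<omega>))"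
      by eventually_elim (use 3(1) in blast)
  qed
qed

text \<open>
  Through the first projection, deterministic limits become limits in probability.
\<close>

lemma filterlim_fst_in_prob: "filterlim fst sequentially (in_prob M)"
  unfolding filterlim_iff eventually_in_prob
  by (auto elim!: eventually_mono intro!: bexI[of _ "{}"])

lemma eventually_snd_in_prob: "\<forall>\<^sub>F p in in_prob M. snd p \<in> space M"
  unfolding eventually_in_prob by (auto intro!: always_eventually bexI[of _ "{}"])

lemma eventually_fst_in_prob:
  "eventually P sequentially \<Longrightarrow> \<forall>\<^sub>F p in in_prob M. P (fst p)"
  using filterlim_fst_in_prob unfolding filterlim_iff by blast

lemma tendsto_fst_in_prob:
  "(a \<longlongrightarrow> L) sequentially \<Longrightarrow> ((\<lambda>p. a (fst p)) \<longlongrightarrow> L) (in_prob M)"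
  by (rule filterlim_compose[OF _ filterlim_fst_in_prob])

lemma markov_bound:
  assumes "integrable M Z" "0 < c"
  shows "{\<omega>\<in>space M. \<bar>Z \<omega>\<bar> \<ge> c} \<in> sets M"
    and "prob {\<omega>\<in>space M. \<bar>Z \<omega>\<bar> \<ge> c} \<le> expectation (\<lambda>\<omega>. \<bar>Z \<omega>\<bar>) / c"
proof -
  have [measurable]: "Z \<in> borel_measurable M" using assms by simp
  show "{\<omega>\<in>space M. \<bar>Z \<omega>\<bar> \<ge> c} \<in> sets M" by measurable
  show "prob {\<omega>\<in>space M. \<bar>Z \<omega>\<bar> \<ge> c} \<le> expectation (\<lambda>\<omega>. \<bar>Z \<omega>\<bar>) / c"
    using integral_Markov_inequality_measure[of M "\<lambda>\<omega>. \<bar>Z \<omega>\<bar>" "space M" c] assms by simp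
qed

lemma tendsto_in_prob_if_L1:
  fixes Z :: "nat \<Rightarrow> 'a \<Rightarrow> real"
  assumes int: "\<forall>\<^sub>F n in sequentially. integrable M (Z n)"
    and lim: "(\<lambda>n. expectation (\<lambda>\<omega>. \<bar>Z n \<omega>\<bar>)) \<longlonglongrightarrow> 0"
  shows "((\<lambda>p. Z (fst p) (snd p)) \<longlongrightarrow> 0) (in_prob M)"
proof (rule tendstoI)
  fix e :: real assume e: "e > 0"
  show "\<forall>\<^sub>F p in in_prob M. dist (Z (fst p) (snd p)) 0 < e"
    unfolding eventually_in_prob
  proof (intro allI impI)
    fix d :: real assume "d > 0"
    then have "\<forall>\<^sub>F n in sequentially. expectation (\<lambda>\<omega>. \<bar>Z n \<omega>\<bar>) < d * e"
      using e by (intro order_tendstoD(2)[OF lim]) auto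
    then show "\<forall>\<^sub>F n in sequentially. \<exists>E\<in>sets M. prob E \<le> d \<and>
        (\<forall>\<omega>\<in>space M - E. dist (Z (fst (n, \<omega>)) (snd (n, \<omega>))) 0 < e)"
      using int
    proof eventually_elim
      case (elim n)
      have "expectation (\<lambda>\<omega>. \<bar>Z n \<omega>\<bar>) / e \<le> d"
        using elim(1) e by (simp add: divide_le_eq)
      with markov_bound[OF elim(2) e] show ?case
        by (intro bexI[of _ "{\<omega>\<in>space M. \<bar>Z n \<omega>\<bar> \<ge> e}"]) (auto simp: not_le dist_real_def)
    qed
  qed
qed

lemma tendsto_in_prob_if_L2:
  fixes Z :: "nat \<Rightarrow> 'a \<Rightarrow> real"
  assumes int: "\<forall>\<^sub>F n in sequentially. integrable M (\<lambda>\<omega>. (Z n \<omega>)\<^sup>2)"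
    and lim: "(\<lambda>n. expectation (\<lambda>\<omega>. (Z n \<omega>)\<^sup>2)) \<longlonglongrightarrow> 0"
  shows "((\<lambda>p. Z (fst p) (snd p)) \<longlongrightarrow> 0) (in_prob M)"
proof -
  have "((\<lambda>p. (Z (fst p) (snd p))\<^sup>2) \<longlongrightarrow> 0) (in_prob M)"
    using tendsto_in_prob_if_L1[of "\<lambda>n \<omega>. (Z n \<omega>)\<^sup>2"] assms by simp
  then have "((\<lambda>p. sqrt ((Z (fst p) (snd p))\<^sup>2)) \<longlongrightarrow> sqrt 0) (in_prob M)"
    by (rule tendsto_real_sqrt)
  then show ?thesis by (simp add: tendsto_rabs_zero_iff)
qed

lemma tight_rvs_if_L2_bounded:
  fixes Z :: "nat \<Rightarrow> 'a \<Rightarrow> real"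
  assumes int: "\<forall>\<^sub>F n in sequentially. integrable M (\<lambda>\<omega>. (Z n \<omega>)\<^sup>2)"
    and bound: "\<forall>\<^sub>F n in sequentially. expectation (\<lambda>\<omega>. (Z n \<omega>)\<^sup>2) \<le> C"
  shows "tight_rvs M Z"
  unfolding tight_rvs_def
proof (intro allI impI)
  fix d :: real assume d: "d > 0"
  \<comment> \<open>Chosen so that Chebyshev's bound \<open>C / B\<^sup>2\<close> is at most \<open>d\<close>.\<close>
  define B where "B = sqrt ((\<bar>C\<bar> + 1) / d)"
  have B: "B > 0" "B\<^sup>2 = (\<bar>C\<bar> + 1) / d" using d by (auto simp: B_def)
  show "\<exists>B>0. \<forall>\<^sub>F n in sequentially. \<exists>E\<in>sets M. prob E \<le> d \<and> (\<forall>\<omega>\<in>space M - E. \<bar>Z n \<omega>\<bar> \<le> B)"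
  proof (intro exI conjI)
    show "\<forall>\<^sub>F n in sequentially. \<exists>E\<in>sets M. prob E \<le> d \<and> (\<forall>\<omega>\<in>space M - E. \<bar>Z n \<omega>\<bar> \<le> B)"
      using int bound
    proof eventually_elim
      case (elim n)
      have "prob {\<omega>\<in>space M. \<bar>(Z n \<omega>)\<^sup>2\<bar> \<ge> B\<^sup>2} \<le> expectation (\<lambda>\<omega>. \<bar>(Z n \<omega>)\<^sup>2\<bar>) / B\<^sup>2"
        using elim(1) B(1) by (intro markov_bound) auto
      also have "\<dots> \<le> (\<bar>C\<bar> + 1) / B\<^sup>2"
        using elim(2) by (intro divide_right_mono) auto
      also have "\<dots> = d" using d B(2) by simp
      finally have *: "prob {\<omega>\<in>space M. \<bar>(Z n \<omega>)\<^sup>2\<bar> \<ge> B\<^sup>2} \<le> d" .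
      have "\<bar>Z n \<omega>\<bar> \<le> B" if "\<not> \<bar>(Z n \<omega>)\<^sup>2\<bar> \<ge> B\<^sup>2" for \<omega>
        using that abs_le_square_iff[of "Z n \<omega>" B] B(1) by simp
      with * markov_bound(1)[OF elim(1), of "B\<^sup>2"] B(1) show ?case
        by (intro bexI[of _ "{\<omega>\<in>space M. \<bar>(Z n \<omega>)\<^sup>2\<bar> \<ge> B\<^sup>2}"]) auto
    qed
  qed (rule B(1))
qed

text \<open>
  Localisation: to show that \<open>P\<close> holds with probability tending to one, a tight sequence may be
  assumed to be bounded by a constant, because the exceptional event has arbitrarily small probability
  once the constant is large.
\<close>

lemma eventually_in_prob_if_tight:
  assumes tight: "tight_rvs M Z"
    and ev: "\<And>B. B > 0 \<Longrightarrow> \<forall>\<^sub>F p in in_prob M. \<bar>Z (fst p) (snd p)\<bar> \<le> B \<longrightarrow> P p"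
  shows "eventually P (in_prob M)"
  unfolding eventually_in_prob
proof (intro allI impI)
  fix d :: real assume d: "d > 0"
  then obtain B where B: "B > 0" "\<forall>\<^sub>F n in sequentially.
      \<exists>E\<in>sets M. prob E \<le> d / 2 \<and> (\<forall>\<omega>\<in>space M - E. \<bar>Z n \<omega>\<bar> \<le> B)"
    using tight unfolding tight_rvs_def by (meson half_gt_zero)
  have "\<forall>\<^sub>F n in sequentially.
      \<exists>E\<in>sets M. prob E \<le> d / 2 \<and> (\<forall>\<omega>\<in>space M - E. \<bar>Z n \<omega>\<bar> \<le> B \<longrightarrow> P (n, \<omega>))"
    using ev[OF B(1)] d unfolding eventually_in_prob by (auto dest!: spec[of _ "d / 2"])
  with B(2) show "\<forall>\<^sub>F n in sequentially. \<exists>E\<in>sets M. prob E \<le> d \<and> (\<forall>\<omega>\<in>space M - E. P (n, \<omega>))"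
  proof eventually_elim
    case (elim n)
    then obtain E F where EF: "E \<in> sets M" "prob E \<le> d / 2" "\<forall>\<omega>\<in>space M - E. \<bar>Z n \<omega>\<bar> \<le> B"
      "F \<in> sets M" "prob F \<le> d / 2" "\<forall>\<omega>\<in>space M - F. \<bar>Z n \<omega>\<bar> \<le> B \<longrightarrow> P (n, \<omega>)" by blast
    have "prob (E \<union> F) \<le> d"
      using measure_Un_le[OF EF(1,4)] EF(2,5) by linarith
    with EF show ?case by (intro bexI[of _ "E \<union> F"]) auto
  qed
qed

lemma tight_rvs_mult_tendsto_0:
  assumes tight: "tight_rvs M Z" and lim: "(W \<longlongrightarrow> 0) (in_prob M)"
  shows "((\<lambda>p. Z (fst p) (snd p) * W p) \<longlongrightarrow> (0::real)) (in_prob M)"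
proof (rule tendstoI)
  fix e :: real assume e: "e > 0"
  show "\<forall>\<^sub>F p in in_prob M. dist (Z (fst p) (snd p) * W p) 0 < e"
  proof (rule eventually_in_prob_if_tight[OF tight])
    fix B :: real assume B: "B > 0"
    have "\<forall>\<^sub>F p in in_prob M. dist (W p) 0 < e / B"
      using lim e B by (intro tendstoD) auto
    then show "\<forall>\<^sub>F p in in_prob M. \<bar>Z (fst p) (snd p)\<bar> \<le> B \<longrightarrow> dist (Z (fst p) (snd p) * W p) 0 < e"
    proof eventually_elim
      case (elim p)
      show ?case
      proof
        assume "\<bar>Z (fst p) (snd p)\<bar> \<le> B"
        then have "\<bar>Z (fst p) (snd p)\<bar> * \<bar>W p\<bar> \<le> B * \<bar>W p\<bar>" by (intro mult_right_mono) auto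
        also have "\<dots> < e" using elim B by (simp add: dist_real_def less_divide_eq mult.commute)
        finally show "dist (Z (fst p) (snd p) * W p) 0 < e" by (simp add: dist_real_def abs_mult)
      qed
    qed
  qed
qed

lemma tight_rvs_cong_in_prob:
  assumes tight: "tight_rvs M Z"
    and lim: "((\<lambda>p. Y (fst p) (snd p) - Z (fst p) (snd p)) \<longlongrightarrow> 0) (in_prob M)"
  shows "tight_rvs M Y"
  unfolding tight_rvs_def
proof (intro allI impI)
  fix d :: real assume d: "d > 0"
  then obtain B where B: "B > 0" "\<forall>\<^sub>F n in sequentially.
      \<exists>E\<in>sets M. prob E \<le> d / 2 \<and> (\<forall>\<omega>\<in>space M - E. \<bar>Z n \<omega>\<bar> \<le> B)"
    using tight unfolding tight_rvs_def by (meson half_gt_zero)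
  have "\<forall>\<^sub>F p in in_prob M. dist (Y (fst p) (snd p) - Z (fst p) (snd p)) 0 < 1"
    by (rule tendstoD[OF lim]) simp
  then have "\<forall>\<^sub>F n in sequentially.
      \<exists>E\<in>sets M. prob E \<le> d / 2 \<and> (\<forall>\<omega>\<in>space M - E. \<bar>Y n \<omega> - Z n \<omega>\<bar> < 1)"
    using d unfolding eventually_in_prob by (auto dest!: spec[of _ "d / 2"] simp: dist_real_def)
  with B(2) have "\<forall>\<^sub>F n in sequentially. \<exists>E\<in>sets M. prob E \<le> d \<and> (\<forall>\<omega>\<in>space M - E. \<bar>Y n \<omega>\<bar> \<le> B + 1)"
  proof eventually_elim
    case (elim n)
    then obtain E F where EF: "E \<in> sets M" "prob E \<le> d / 2" "\<forall>\<omega>\<in>space M - E. \<bar>Z n \<omega>\<bar> \<le> B"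
      "F \<in> sets M" "prob F \<le> d / 2" "\<forall>\<omega>\<in>space M - F. \<bar>Y n \<omega> - Z n \<omega>\<bar> < 1" by blast
    have "prob (E \<union> F) \<le> d"
      using measure_Un_le[OF EF(1,4)] EF(2,5) by linarith
    moreover have "\<bar>Y n \<omega>\<bar> \<le> B + 1" if "\<omega> \<in> space M - (E \<union> F)" for \<omega>
      using EF(3,6) that by (auto dest!: bspec[of _ _ \<omega>])
    ultimately show ?case using EF by (intro bexI[of _ "E \<union> F"]) auto
  qed
  then show "\<exists>B>0. \<forall>\<^sub>F n in sequentially. \<exists>E\<in>sets M. prob E \<le> d \<and> (\<forall>\<omega>\<in>space M - E. \<bar>Y n \<omega>\<bar> \<le> B)"
    using B(1) by (intro exI[of _ "B + 1"]) auto
qed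

text \<open>
  The characteristic functions of \<open>Z n\<close> and \<open>S n\<close> at \<open>t\<close> differ by at most
  \<open>\<bar>t\<bar> \<delta> + 2 P(\<bar>Z n - S n\<bar> \<ge> \<delta>)\<close>, and pointwise convergence of characteristic functions gives weak
  convergence by Levy's continuity theorem.
\<close>

lemma slutsky:
  assumes [measurable]: "\<And>n. Z n \<in> borel_measurable M" "\<And>n. S n \<in> borel_measurable M"
    and conv: "weak_conv_m (\<lambda>n. distr M borel (S n)) L" and L: "real_distribution L"
    and lim: "((\<lambda>p. Z (fst p) (snd p) - S (fst p) (snd p)) \<longlongrightarrow> 0) (in_prob M)"
  shows "weak_conv_m (\<lambda>n. distr M borel (Z n)) L"
proof (rule levy_continuity)
  fix t :: real
  have int: "integrable M (\<lambda>\<omega>. iexp (t * Z n \<omega>))" "integrable M (\<lambda>\<omega>. iexp (t * S n \<omega>))" for n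
    using integrable_iexp[of "\<lambda>\<omega>. complex_of_real (t * Z n \<omega>)"]
      integrable_iexp[of "\<lambda>\<omega>. complex_of_real (t * S n \<omega>)"] by simp_all
  have "(\<lambda>n. char (distr M borel (Z n)) t - char (distr M borel (S n)) t) \<longlonglongrightarrow> 0"
  proof (rule tendstoI)
    fix e :: real assume e: "e > 0"
    \<comment> \<open>Off an event of probability \<open>e / 8\<close> the integrand is at most \<open>\<bar>t\<bar> * \<delta> < e / 2\<close>.\<close>
    define \<delta> where "\<delta> = e / (2 * (\<bar>t\<bar> + 1))"
    have \<delta>: "\<delta> > 0" "\<bar>t\<bar> * \<delta> < e / 2"
      using e by (auto simp: \<delta>_def field_simps)
    have "\<forall>\<^sub>F p in in_prob M. dist (Z (fst p) (snd p) - S (fst p) (snd p)) 0 < \<delta>"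
      by (rule tendstoD[OF lim \<delta>(1)])
    then have "\<forall>\<^sub>F n in sequentially. \<exists>E\<in>sets M. prob E \<le> e / 8 \<and>
        (\<forall>\<omega>\<in>space M - E. \<bar>Z n \<omega> - S n \<omega>\<bar> < \<delta>)"
      using e unfolding eventually_in_prob by (auto dest!: spec[of _ "e / 8"] simp: dist_real_def)
    then show "\<forall>\<^sub>F n in sequentially.
        dist (char (distr M borel (Z n)) t - char (distr M borel (S n)) t) 0 < e"
    proof eventually_elim
      case (elim n)
      then obtain E where E [measurable]: "E \<in> sets M" and "prob E \<le> e / 8"
        and small: "\<And>\<omega>. \<omega> \<in> space M \<Longrightarrow> \<omega> \<notin> E \<Longrightarrow> \<bar>Z n \<omega> - S n \<omega>\<bar> < \<delta>" by blast
      have "norm (char (distr M borel (Z n)) t - char (distr M borel (S n)) t)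
          = norm (LINT \<omega>|M. iexp (t * Z n \<omega>) - iexp (t * S n \<omega>))"
        by (simp add: char_def integral_distr Bochner_Integration.integral_diff[OF int] del: of_real_mult)
      also have "\<dots> \<le> (LINT \<omega>|M. norm (iexp (t * Z n \<omega>) - iexp (t * S n \<omega>)))"
        by (rule integral_norm_bound)
      also have "\<dots> \<le> (LINT \<omega>|M. \<bar>t\<bar> * \<delta> + 2 * indicator E \<omega>)"
      proof (rule integral_mono)
        fix \<omega> assume \<omega>: "\<omega> \<in> space M"
        show "norm (iexp (t * Z n \<omega>) - iexp (t * S n \<omega>)) \<le> \<bar>t\<bar> * \<delta> + 2 * indicator E \<omega>"
        proof (cases "\<omega> \<in> E")
          case True
          then show ?thesis
            using norm_iexp_diff_le(2)[of "t * Z n \<omega>" "t * S n \<omega>"] \<delta>(1) by (simp add: add_increasing)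
        next
          case False
          have "norm (iexp (t * Z n \<omega>) - iexp (t * S n \<omega>)) \<le> \<bar>t\<bar> * \<bar>Z n \<omega> - S n \<omega>\<bar>"
            using norm_iexp_diff_le(1)[of "t * Z n \<omega>" "t * S n \<omega>"]
            by (simp add: abs_mult[symmetric] right_diff_distrib)
          also have "\<dots> \<le> \<bar>t\<bar> * \<delta>"
            using small[OF \<omega> False] by (intro mult_left_mono) auto
          finally show ?thesis using False by simp
        qed
      next
        show "integrable M (\<lambda>\<omega>. norm (iexp (t * Z n \<omega>) - iexp (t * S n \<omega>)))"
          by (intro integrable_norm Bochner_Integration.integrable_diff int)
        show "integrable M (\<lambda>\<omega>. \<bar>t\<bar> * \<delta> + 2 * indicator E \<omega> :: real)"
          by (auto simp: less_top[symmetric])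
      qed
      also have "\<dots> = \<bar>t\<bar> * \<delta> + 2 * prob E"
        by (subst Bochner_Integration.integral_add) (auto simp: prob_space less_top[symmetric])
      also have "\<dots> < e" using \<delta>(2) \<open>prob E \<le> e / 8\<close> e by linarith
      finally show ?case by (simp add: dist_norm)
    qed
  qed
  moreover have "(\<lambda>n. char (distr M borel (S n)) t) \<longlonglongrightarrow> char L t"
    by (rule levy_continuity1[OF _ L conv]) (simp add: real_distribution_distr)
  ultimately have "(\<lambda>n. char (distr M borel (Z n)) t - char (distr M borel (S n)) t
      + char (distr M borel (S n)) t) \<longlonglongrightarrow> 0 + char L t"
    by (rule tendsto_add)
  then show "(\<lambda>n. char (distr M borel (Z n)) t) \<longlonglongrightarrow> char L t" by simp
qed (simp_all add: L real_distribution_distr)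

end

section \<open>Sums of independent identically distributed variables\<close>

lemma (in prob_space) indep_vars_reindex:
  assumes indep: "indep_vars N X (f ` I)" and inj: "inj_on f I"
  shows "indep_vars (\<lambda>i. N (f i)) (\<lambda>i. X (f i)) I"
  unfolding indep_vars_def2
proof (intro conjI ballI)
  fix i assume "i \<in> I"
  then show "random_variable (N (f i)) (X (f i))"
    using indep unfolding indep_vars_def2 by auto
next
  let ?F = "\<lambda>i. {X i -` A \<inter> space M |A. A \<in> sets (N i)}"
  have F: "indep_sets ?F (f ` I)" using indep unfolding indep_vars_def2 by simp
  show "indep_sets (\<lambda>i. ?F (f i)) I"
  proof (rule indep_setsI)
    fix i assume "i \<in> I" then show "?F (f i) \<subseteq> events"
      using F unfolding indep_sets_def by auto
  next
    fix A J assume J: "J \<noteq> {}" "J \<subseteq> I" "finite J" "\<forall>j\<in>J. A j \<in> ?F (f j)"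
    define g where "g = the_inv_into I f"
    have g: "g (f j) = j" if "j \<in> J" for j
      using that J(2) inj by (auto simp: g_def the_inv_into_f_f)
    have injJ: "inj_on f J" using inj J(2) by (rule inj_on_subset)
    have "prob (\<Inter>j\<in>f ` J. A (g j)) = (\<Prod>j\<in>f ` J. prob (A (g j)))"
      by (rule indep_setsD[OF F]) (use J g in auto)
    then show "prob (\<Inter> (A ` J)) = (\<Prod>j\<in>J. prob (A j))"
      by (simp add: prod.reindex[OF injJ] g cong: INF_cong prod.cong)
  qed
qed

text \<open>
  The mixed terms vanish, being products of independent centred variables.
\<close>

lemma (in prob_space) second_moment_sum_indep:
  fixes Z :: "'i \<Rightarrow> 'a \<Rightarrow> real"
  assumes "finite I" and "indep_vars (\<lambda>_. borel) Z I"
    and sq: "\<And>i. i \<in> I \<Longrightarrow> integrable M (\<lambda>\<omega>. (Z i \<omega>)\<^sup>2)"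
    and mean: "\<And>i. i \<in> I \<Longrightarrow> expectation (Z i) = 0"
  shows "integrable M (\<lambda>\<omega>. (\<Sum>i\<in>I. Z i \<omega>)\<^sup>2) \<and>
    expectation (\<lambda>\<omega>. (\<Sum>i\<in>I. Z i \<omega>)\<^sup>2) = (\<Sum>i\<in>I. expectation (\<lambda>\<omega>. (Z i \<omega>)\<^sup>2))"
  using assms
proof (induction I rule: finite_induct)
  case empty then show ?case by simp
next
  case (insert i I)
  have meas: "Z j \<in> borel_measurable M" if "j \<in> insert i I" for j
    using insert.prems(1) that unfolding indep_vars_def2 by auto
  have int: "integrable M (Z j)" if "j \<in> insert i I" for j
    using square_integrable_imp_integrable[OF meas insert.prems(2)] that by blast
  have IH: "integrable M (\<lambda>\<omega>. (\<Sum>i\<in>I. Z i \<omega>)\<^sup>2)"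
    "expectation (\<lambda>\<omega>. (\<Sum>i\<in>I. Z i \<omega>)\<^sup>2) = (\<Sum>i\<in>I. expectation (\<lambda>\<omega>. (Z i \<omega>)\<^sup>2))"
    using insert.IH indep_vars_subset[OF insert.prems(1)] insert.prems by auto
  have iv: "indep_var borel (Z i) borel (\<lambda>\<omega>. \<Sum>j\<in>I. Z j \<omega>)"
    by (rule indep_vars_sum) (use insert in auto)
  have intI: "integrable M (\<lambda>\<omega>. \<Sum>j\<in>I. Z j \<omega>)"
    by (intro Bochner_Integration.integrable_sum int) auto
  have cross: "integrable M (\<lambda>\<omega>. Z i \<omega> * (\<Sum>j\<in>I. Z j \<omega>))"
    "expectation (\<lambda>\<omega>. Z i \<omega> * (\<Sum>j\<in>I. Z j \<omega>)) = 0"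
    using indep_var_integrable[OF iv int[of i] intI] indep_var_lebesgue_integral[OF iv int[of i] intI]
      insert.prems(3)[of i] by auto
  have eq: "(\<Sum>j\<in>insert i I. Z j \<omega>)\<^sup>2 =
      (Z i \<omega>)\<^sup>2 + (2 * (Z i \<omega> * (\<Sum>j\<in>I. Z j \<omega>)) + (\<Sum>j\<in>I. Z j \<omega>)\<^sup>2)" for \<omega>
    using insert.hyps by (simp add: power2_sum algebra_simps)
  have i1: "integrable M (\<lambda>\<omega>. 2 * (Z i \<omega> * (\<Sum>j\<in>I. Z j \<omega>)) + (\<Sum>j\<in>I. Z j \<omega>)\<^sup>2)"
    by (intro Bochner_Integration.integrable_add integrable_mult_right cross IH)
  have "expectation (\<lambda>\<omega>. 2 * (Z i \<omega> * (\<Sum>j\<in>I. Z j \<omega>)) + (\<Sum>j\<in>I. Z j \<omega>)\<^sup>2) =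
      expectation (\<lambda>\<omega>. (\<Sum>j\<in>I. Z j \<omega>)\<^sup>2)"
    by (subst Bochner_Integration.integral_add) (auto simp: cross IH(1))
  then show ?case
    unfolding eq using insert.hyps insert.prems(2)[of i] i1 IH
    by (simp add: Bochner_Integration.integral_add)
qed

locale iid_sample = prob_space M for M :: "'a measure" +
  fixes Y :: "nat \<Rightarrow> 'a \<Rightarrow> real" and N :: "real measure"
  assumes indep: "indep_vars (\<lambda>_. borel) Y UNIV"
    and law: "\<And>i. distr M borel (Y i) = N"
begin

lemma Y_meas [measurable]: "Y i \<in> borel_measurable M"
  using indep unfolding indep_vars_def2 by auto

lemma real_distribution_law: "real_distribution N"
  using real_distribution_distr[OF Y_meas[of 0]] law[of 0] by simp

sublocale N: real_distribution N by (rule real_distribution_law)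

lemma N_prob_UNIV [simp]: "N.prob UNIV = 1"
  using N.prob_space by simp

lemma integrable_law_iff:
  fixes g :: "real \<Rightarrow> real"
  shows "g \<in> borel_measurable borel \<Longrightarrow> integrable M (\<lambda>\<omega>. g (Y i \<omega>)) \<longleftrightarrow> integrable N g"
  using integrable_distr_eq[OF Y_meas, of g i] law by simp

lemma expectation_law:
  fixes g :: "real \<Rightarrow> real"
  shows "g \<in> borel_measurable borel \<Longrightarrow> expectation (\<lambda>\<omega>. g (Y i \<omega>)) = N.expectation g"
  using integral_distr[OF Y_meas, of g i] law by simp

lemma second_moment_sum:
  assumes [measurable]: "g \<in> borel_measurable borel"
    and sq: "integrable N (\<lambda>y. (g y)\<^sup>2)" and mean: "N.expectation g = 0"
  shows "integrable M (\<lambda>\<omega>. (\<Sum>i<n. g (Y i \<omega>))\<^sup>2)"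
    and "expectation (\<lambda>\<omega>. (\<Sum>i<n. g (Y i \<omega>))\<^sup>2) = n * N.expectation (\<lambda>y. (g y)\<^sup>2)"
proof -
  have "indep_vars (\<lambda>_. borel) (\<lambda>i \<omega>. g (Y i \<omega>)) {..<n}"
    by (rule indep_vars_compose2[OF indep_vars_subset[OF indep]]) auto
  moreover have "integrable M (\<lambda>\<omega>. (g (Y i \<omega>))\<^sup>2)" for i
    using integrable_law_iff[of "\<lambda>y. (g y)\<^sup>2"] sq by simp
  moreover have "expectation (\<lambda>\<omega>. g (Y i \<omega>)) = 0" for i
    using expectation_law[of g] mean by simp
  moreover have "expectation (\<lambda>\<omega>. (g (Y i \<omega>))\<^sup>2) = N.expectation (\<lambda>y. (g y)\<^sup>2)" for i
    using expectation_law[of "\<lambda>y. (g y)\<^sup>2"] by simp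
  ultimately show "integrable M (\<lambda>\<omega>. (\<Sum>i<n. g (Y i \<omega>))\<^sup>2)"
    and "expectation (\<lambda>\<omega>. (\<Sum>i<n. g (Y i \<omega>))\<^sup>2) = n * N.expectation (\<lambda>y. (g y)\<^sup>2)"
    using second_moment_sum_indep[of "{..<n}" "\<lambda>i \<omega>. g (Y i \<omega>)"] by auto
qed

lemma second_moment_normalized_sum:
  assumes "g \<in> borel_measurable borel"
    and "integrable N (\<lambda>y. (g y)\<^sup>2)" and "N.expectation g = 0" and "n > 0"
  shows "integrable M (\<lambda>\<omega>. ((\<Sum>i<n. g (Y i \<omega>)) / sqrt n)\<^sup>2)"
    and "expectation (\<lambda>\<omega>. ((\<Sum>i<n. g (Y i \<omega>)) / sqrt n)\<^sup>2) = N.expectation (\<lambda>y. (g y)\<^sup>2)"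
  using second_moment_sum[OF assms(1-3), of n] assms(4) by (simp_all add: power_divide)

text \<open>
  Chebyshev's inequality for a triangular array whose rows apply one function \<open>g n\<close> to the sample:
  the second moment of the normalised sum is that of a single summand.
\<close>

lemma normalized_sum_in_prob_0:
  assumes meas: "\<And>n. g n \<in> borel_measurable borel"
    and sq: "\<forall>\<^sub>F n in sequentially. integrable N (\<lambda>y. (g n y)\<^sup>2)"
    and mean: "\<forall>\<^sub>F n in sequentially. N.expectation (g n) = 0"
    and lim: "(\<lambda>n. N.expectation (\<lambda>y. (g n y)\<^sup>2)) \<longlonglongrightarrow> 0"
  shows "((\<lambda>p. (\<Sum>i<fst p. g (fst p) (Y i (snd p))) / sqrt (real (fst p))) \<longlongrightarrow> 0) (in_prob M)"
proof -
  let ?Z = "\<lambda>n \<omega>. (\<Sum>i<n. g n (Y i \<omega>)) / sqrt n"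
  have "\<forall>\<^sub>F n in sequentially. integrable M (\<lambda>\<omega>. (?Z n \<omega>)\<^sup>2)"
    using sq mean eventually_gt_at_top[of 0]
    by eventually_elim (rule second_moment_normalized_sum(1)[OF meas])
  moreover have "\<forall>\<^sub>F n in sequentially. expectation (\<lambda>\<omega>. (?Z n \<omega>)\<^sup>2) = N.expectation (\<lambda>y. (g n y)\<^sup>2)"
    using sq mean eventually_gt_at_top[of 0]
    by eventually_elim (rule second_moment_normalized_sum(2)[OF meas])
  then have "(\<lambda>n. expectation (\<lambda>\<omega>. (?Z n \<omega>)\<^sup>2)) \<longlonglongrightarrow> 0"
    using lim by (simp add: tendsto_cong)
  ultimately show ?thesis by (rule tendsto_in_prob_if_L2)
qed

lemma average_in_prob_0:
  assumes K: "integrable N K" and a: "a \<longlonglongrightarrow> 0"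
  shows "((\<lambda>p. a (fst p) * ((\<Sum>i<fst p. K (Y i (snd p))) / real (fst p))) \<longlongrightarrow> (0::real)) (in_prob M)"
proof -
  have [measurable]: "K \<in> borel_measurable borel" using borel_measurable_integrable[OF K] by simp
  let ?Z = "\<lambda>n \<omega>. a n * ((\<Sum>i<n. K (Y i \<omega>)) / n)"
  have iK: "integrable M (\<lambda>\<omega>. K (Y i \<omega>))" for i using K by (simp add: integrable_law_iff)
  have int: "integrable M (?Z n)" for n
    by (intro integrable_mult_right integrable_divide Bochner_Integration.integrable_sum iK)
  have "expectation (\<lambda>\<omega>. \<bar>?Z n \<omega>\<bar>) \<le> \<bar>a n\<bar> * N.expectation (\<lambda>y. \<bar>K y\<bar>)" for n
  proof (cases "n = 0")
    case True
    then show ?thesis by simp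
  next
    case False
    have "expectation (\<lambda>\<omega>. \<bar>?Z n \<omega>\<bar>) \<le> expectation (\<lambda>\<omega>. \<bar>a n\<bar> * ((\<Sum>i<n. \<bar>K (Y i \<omega>)\<bar>) / n))"
    proof (rule integral_mono)
      show "\<bar>?Z n \<omega>\<bar> \<le> \<bar>a n\<bar> * ((\<Sum>i<n. \<bar>K (Y i \<omega>)\<bar>) / n)" for \<omega>
        unfolding abs_mult abs_divide
        by (intro mult_left_mono) (auto intro!: divide_right_mono sum_abs)
    qed (intro integrable_abs int integrable_mult_right integrable_divide
        Bochner_Integration.integrable_sum iK)+
    also have "\<dots> = \<bar>a n\<bar> * ((\<Sum>i<n. expectation (\<lambda>\<omega>. \<bar>K (Y i \<omega>)\<bar>)) / n)"
      by (simp add: Bochner_Integration.integral_sum iK)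
    also have "\<dots> = \<bar>a n\<bar> * N.expectation (\<lambda>y. \<bar>K y\<bar>)"
      using False expectation_law[of "\<lambda>y. \<bar>K y\<bar>"] by simp
    finally show ?thesis .
  qed
  moreover have "(\<lambda>n. \<bar>a n\<bar> * N.expectation (\<lambda>y. \<bar>K y\<bar>)) \<longlonglongrightarrow> 0"
    using a by (intro tendsto_mult_left_zero tendsto_rabs_zero)
  ultimately have "(\<lambda>n. expectation (\<lambda>\<omega>. \<bar>?Z n \<omega>\<bar>)) \<longlonglongrightarrow> 0"
    using Lim_null_comparison[of "\<lambda>n. expectation (\<lambda>\<omega>. \<bar>?Z n \<omega>\<bar>)"
        "\<lambda>n. \<bar>a n\<bar> * N.expectation (\<lambda>y. \<bar>K y\<bar>)" sequentially]
    by (simp add: always_eventually)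
  with int show ?thesis
    using tendsto_in_prob_if_L1[of ?Z] by simp
qed

lemma weak_law_of_large_numbers:
  assumes sq: "integrable N (\<lambda>y. y\<^sup>2)"
  shows "((\<lambda>p. (\<Sum>i<fst p. Y i (snd p)) / real (fst p)) \<longlongrightarrow> N.expectation (\<lambda>y. y)) (in_prob M)"
proof -
  let ?m = "N.expectation (\<lambda>y. y)"
  have int: "integrable N (\<lambda>y. y)"
    by (rule N.square_integrable_imp_integrable[OF _ sq]) simp
  \<comment> \<open>The average is the normalised sum of the functions \<open>(y - ?m) / sqrt n\<close>, of variance \<open>O(1 / n)\<close>.\<close>
  let ?g = "\<lambda>n y. (y - ?m) / sqrt (real n)"
  have isq: "integrable N (\<lambda>y. (y - ?m)\<^sup>2)"
    unfolding power2_diff using sq int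
    by (intro Bochner_Integration.integrable_add Bochner_Integration.integrable_diff) auto
  have E: "N.expectation (\<lambda>y. (?g n y)\<^sup>2) = N.expectation (\<lambda>y. (y - ?m)\<^sup>2) / real n" for n
    by (simp add: power_divide)
  have "((\<lambda>p. (\<Sum>i<fst p. ?g (fst p) (Y i (snd p))) / sqrt (real (fst p))) \<longlongrightarrow> 0) (in_prob M)"
  proof (rule normalized_sum_in_prob_0)
    show "(\<lambda>n. N.expectation (\<lambda>y. (?g n y)\<^sup>2)) \<longlonglongrightarrow> 0"
      unfolding E by (rule lim_const_over_n)
    show "\<forall>\<^sub>F n in sequentially. integrable N (\<lambda>y. (?g n y)\<^sup>2)"
      unfolding power_divide by (intro always_eventually allI integrable_divide isq)
    have "N.expectation (\<lambda>y. y - ?m) = 0" using int by (simp add: N.prob_space)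
    then show "\<forall>\<^sub>F n in sequentially. N.expectation (?g n) = 0" by simp
  qed simp
  moreover have "\<forall>\<^sub>F p in in_prob M. (\<Sum>i<fst p. ?g (fst p) (Y i (snd p))) / sqrt (real (fst p)) =
      (\<Sum>i<fst p. Y i (snd p)) / real (fst p) - ?m"
    using eventually_fst_in_prob[OF eventually_gt_at_top[of 0]]
  proof eventually_elim
    case (elim p)
    let ?n = "real (fst p)" and ?s = "\<Sum>i<fst p. Y i (snd p)"
    have "(\<Sum>i<fst p. ?g (fst p) (Y i (snd p))) / sqrt ?n = (?s - ?n * ?m) / (sqrt ?n * sqrt ?n)"
      by (simp add: sum_divide_distrib[symmetric] sum_subtractf)
    also have "\<dots> = (?s - ?n * ?m) / ?n" by simp
    also have "\<dots> = ?s / ?n - ?m" using elim by (simp add: diff_divide_distrib)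
    finally show ?case .
  qed
  ultimately have "((\<lambda>p. (\<Sum>i<fst p. Y i (snd p)) / real (fst p) - ?m) \<longlongrightarrow> 0) (in_prob M)"
    by (simp add: tendsto_cong)
  then show ?thesis by (simp add: LIM_zero_iff)
qed

end

section \<open>The cumulant function and the Kullback-Leibler divergence\<close>

text \<open>
  The law \<open>N\<close> of the sufficient statistic under the true parameter, with its exponential tilts.
  The tilt to the parameter \<open>t\<close> has normaliser \<open>exp (A t - A \<theta>0)\<close>, so that \<open>s \<mapsto> A (\<theta>0 + s) - A \<theta>0\<close> is
  the cumulant generating function of \<open>N\<close>.
\<close>

locale cumulant_family = real_distribution N for N :: "real measure" +
  fixes A :: "real \<Rightarrow> real" and \<Theta> :: "real set" and \<theta>0 :: real
  assumes tilt_integrable: "\<And>t. t \<in> \<Theta> \<Longrightarrow> integrable N (\<lambda>y. exp ((t - \<theta>0) * y))"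
    and tilt_expectation: "\<And>t. t \<in> \<Theta> \<Longrightarrow> expectation (\<lambda>y. exp ((t - \<theta>0) * y)) = exp (A t - A \<theta>0)"
    and nondegenerate: "\<not> (\<exists>c. AE y in N. y = c)"
    and compact_params: "compact \<Theta>"
    and interior_param: "\<theta>0 \<in> interior \<Theta>"
begin

definition \<rho> :: real where
  "\<rho> = (SOME r. 0 < r \<and> (\<forall>t. \<bar>t - \<theta>0\<bar> < r \<longrightarrow> t \<in> \<Theta>))"

lemma \<rho>_pos: "0 < \<rho>" and near_in_params: "\<bar>t - \<theta>0\<bar> < \<rho> \<Longrightarrow> t \<in> \<Theta>"
proof -
  obtain r where "r > 0" "ball \<theta>0 r \<subseteq> \<Theta>"
    using interior_param by (auto simp: mem_interior)
  then have "\<exists>r. 0 < r \<and> (\<forall>t. \<bar>t - \<theta>0\<bar> < r \<longrightarrow> t \<in> \<Theta>)"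
    by (intro exI[of _ r]) (auto simp: ball_def dist_real_def subset_iff abs_minus_commute)
  from someI_ex[OF this] show "0 < \<rho>" "\<bar>t - \<theta>0\<bar> < \<rho> \<Longrightarrow> t \<in> \<Theta>"
    unfolding \<rho>_def by blast+
qed

sublocale exp_moments N "\<lambda>y. y" "\<lambda>_. 1" 0 \<rho>
proof
  fix t :: real assume "\<bar>t - 0\<bar> < \<rho>"
  then show "integrable N (\<lambda>x. exp (t * x))"
    using tilt_integrable[OF near_in_params[of "\<theta>0 + t"]] by simp
qed auto

abbreviation mom :: "nat \<Rightarrow> real \<Rightarrow> real" where
  "mom \<equiv> exp_moment N (\<lambda>_. 1) (\<lambda>y. y)"

lemma mom_0: "\<theta>0 + s \<in> \<Theta> \<Longrightarrow> mom 0 s = exp (A (\<theta>0 + s) - A \<theta>0)"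
  using tilt_expectation[of "\<theta>0 + s"] by (simp add: exp_moment_def)

lemma mom_0_pos: "\<bar>s\<bar> < \<rho> \<Longrightarrow> 0 < mom 0 s"
  using mom_0[of s] near_in_params[of "\<theta>0 + s"] by simp

text \<open>
  The first two moments of the score at the surrogate parameter, and the expectation of its derivative, are
  expectations of quadratic polynomials under exponential weights. Expressed by the continuous functions \<open>mom k\<close>, their limits as the weight tends to \<open>1\<close> can be read off.
\<close>

lemma expectation_quadratic_tilted:
  assumes "\<bar>s\<bar> < \<rho>"
  shows "integrable N (\<lambda>y. (\<alpha> + \<beta> * y + \<gamma> * y\<^sup>2) * exp (s * y))"
    and "expectation (\<lambda>y. (\<alpha> + \<beta> * y + \<gamma> * y\<^sup>2) * exp (s * y)) =
      \<alpha> * mom 0 s + \<beta> * mom 1 s + \<gamma> * mom 2 s"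
proof -
  have i: "integrable N (\<lambda>y. 1 * y ^ k * exp (s * y))" for k
    by (rule integrable_moment) (use assms in simp)
  have eq: "(\<alpha> + \<beta> * y + \<gamma> * y\<^sup>2) * exp (s * y) = \<alpha> * (1 * y ^ 0 * exp (s * y)) +
      (\<beta> * (1 * y ^ 1 * exp (s * y)) + \<gamma> * (1 * y ^ 2 * exp (s * y)))" for y
    by (simp add: algebra_simps)
  show "integrable N (\<lambda>y. (\<alpha> + \<beta> * y + \<gamma> * y\<^sup>2) * exp (s * y))"
    unfolding eq by (intro Bochner_Integration.integrable_add integrable_mult_right i)
  show "expectation (\<lambda>y. (\<alpha> + \<beta> * y + \<gamma> * y\<^sup>2) * exp (s * y)) =
      \<alpha> * mom 0 s + \<beta> * mom 1 s + \<gamma> * mom 2 s"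
    unfolding eq
    by (subst Bochner_Integration.integral_add Bochner_Integration.integral_add,
        (intro Bochner_Integration.integrable_add integrable_mult_right i)+)+
      (simp only: integral_mult_right_zero exp_moment_def add.assoc)
qed

text \<open>
  The first and second derivatives of \<open>A\<close> near \<open>\<theta>0\<close>, in closed form.
\<close>

definition A1 :: "real \<Rightarrow> real" where
  "A1 t = mom 1 (t - \<theta>0) / mom 0 (t - \<theta>0)"

definition A2 :: "real \<Rightarrow> real" where
  "A2 t = mom 2 (t - \<theta>0) / mom 0 (t - \<theta>0) - (A1 t)\<^sup>2"

definition mean :: real where "mean = expectation (\<lambda>y. y)"

definition var :: real where "var = expectation (\<lambda>y. (y - mean)\<^sup>2)"

lemma DERIV_mom:
  assumes "\<bar>t - \<theta>0\<bar> < \<rho>"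
  shows "((\<lambda>t. mom k (t - \<theta>0)) has_real_derivative mom (Suc k) (t - \<theta>0)) (at t)"
proof -
  have "(mom k has_real_derivative mom (Suc k) (t - \<theta>0)) (at (t - \<theta>0))"
    by (rule DERIV_exp_moment) (use assms in simp)
  moreover have "((\<lambda>t. t - \<theta>0) has_real_derivative 1) (at t)"
    by (auto intro!: derivative_eq_intros)
  ultimately show ?thesis
    using DERIV_chain2[where f = "mom k" and g = "\<lambda>t. t - \<theta>0" and Db = 1] by simp
qed

lemma near_open: "open {t. \<bar>t - \<theta>0\<bar> < \<rho>}"
  by (intro open_Collect_less continuous_intros)

lemma DERIV_A:
  assumes t: "\<bar>t - \<theta>0\<bar> < \<rho>"
  shows "(A has_real_derivative A1 t) (at t)"
proof (rule has_field_derivative_transform_within_open[OF _ near_open])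
  show "((\<lambda>t. A \<theta>0 + ln (mom 0 (t - \<theta>0))) has_real_derivative A1 t) (at t)"
    using mom_0_pos[OF t]
    by (auto intro!: derivative_eq_intros DERIV_mom t simp: A1_def)
  show "A \<theta>0 + ln (mom 0 (s - \<theta>0)) = A s" if "s \<in> {t. \<bar>t - \<theta>0\<bar> < \<rho>}" for s
    using that mom_0[of "s - \<theta>0"] near_in_params[of s] by simp
qed (use t in simp)

lemma DERIV_A1:
  assumes t: "\<bar>t - \<theta>0\<bar> < \<rho>"
  shows "(A1 has_real_derivative A2 t) (at t)"
proof -
  have "((\<lambda>t. mom 1 (t - \<theta>0) / mom 0 (t - \<theta>0)) has_real_derivative A2 t) (at t)"
    using mom_0_pos[OF t]
    by (auto intro!: derivative_eq_intros DERIV_mom t simp: A2_def A1_def numeral_2_eq_2 power2_eq_square field_simps)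
  then show ?thesis by (simp add: A1_def[abs_def])
qed

lemma isCont_A1: "\<bar>t - \<theta>0\<bar> < \<rho> \<Longrightarrow> isCont A1 t"
  by (rule DERIV_isCont[OF DERIV_A1])

lemma isCont_A2:
  assumes t: "\<bar>t - \<theta>0\<bar> < \<rho>"
  shows "isCont A2 t"
proof -
  have c: "isCont (\<lambda>t. mom k (t - \<theta>0)) t" for k by (rule DERIV_isCont[OF DERIV_mom[OF t]])
  show ?thesis
    unfolding A2_def[abs_def] using mom_0_pos[OF t] isCont_A1[OF t]
    by (intro continuous_intros c) auto
qed

lemma isCont_mom_0: "isCont (mom k) 0"
  by (rule isCont_exp_moment) (use \<rho>_pos in simp)

lemma mom_at_0: "mom 0 0 = 1" "mom (Suc 0) 0 = mean" "mom 2 0 = expectation (\<lambda>y. y\<^sup>2)"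
  using prob_space by (simp_all add: exp_moment_def mean_def)

lemma integrable_id: "integrable N (\<lambda>y. y)" and integrable_square: "integrable N (\<lambda>y. y\<^sup>2)"
  using expectation_quadratic_tilted(1)[of 0 0 1 0] expectation_quadratic_tilted(1)[of 0 0 0 1] \<rho>_pos
  by simp_all

lemma integrable_var: "integrable N (\<lambda>y. (y - mean)\<^sup>2)"
  and var_eq: "var = mom 2 0 - mean\<^sup>2"
proof -
  have eq: "(y - mean)\<^sup>2 = (mean\<^sup>2 + (- 2 * mean) * y + 1 * y\<^sup>2) * exp (0 * y)" for y
    by (simp add: power2_diff algebra_simps)
  show "integrable N (\<lambda>y. (y - mean)\<^sup>2)" "var = mom 2 0 - mean\<^sup>2"
    unfolding var_def eq using expectation_quadratic_tilted[of 0 "mean\<^sup>2" "- 2 * mean" 1] \<rho>_pos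
    by (simp_all add: mom_at_0 power2_eq_square)
qed

lemma A1_\<theta>0: "A1 \<theta>0 = mean" and A2_\<theta>0: "A2 \<theta>0 = var"
  by (simp_all add: A1_def A2_def var_eq mom_at_0)

lemma var_pos: "0 < var"
proof -
  have "var \<noteq> 0"
  proof
    assume "var = 0"
    then have "AE y in N. (y - mean)\<^sup>2 = 0"
      using integral_nonneg_eq_0_iff_AE[OF integrable_var] by (simp add: var_def)
    then have "AE y in N. y = mean" by simp
    then show False using nondegenerate by blast
  qed
  moreover have "0 \<le> var" unfolding var_def by (rule Bochner_Integration.integral_nonneg) simp
  ultimately show ?thesis by simp
qed

text \<open>
  The Kullback-Leibler divergence of the member \<open>t\<close> of the family from the member \<open>\<theta>0\<close>; equivalently,
  the amount by which the expected log-likelihood at \<open>t\<close> falls short of its value at \<open>\<theta>0\<close>.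
\<close>

definition excess :: "real \<Rightarrow> real" where
  "excess t = A t - A \<theta>0 - (t - \<theta>0) * mean"

text \<open>
  The term linear in \<open>y - mean\<close> has expectation zero and leaves the value unchanged. It makes the
  integrand, for every \<open>y\<close>, monotone in \<open>t\<close> on either side of \<open>\<theta>0\<close>.
\<close>

lemma centred_tilt:
  assumes "t \<in> \<Theta>"
  shows "integrable N (\<lambda>y. exp ((t - \<theta>0) * (y - mean)) - (t - \<theta>0) * (y - mean))"
    and "expectation (\<lambda>y. exp ((t - \<theta>0) * (y - mean)) - (t - \<theta>0) * (y - mean)) = exp (excess t)"
proof -
  have eq: "exp ((t - \<theta>0) * (y - mean)) = exp (- (t - \<theta>0) * mean) * exp ((t - \<theta>0) * y)" for y
    by (simp add: exp_add[symmetric] algebra_simps)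
  have i1: "integrable N (\<lambda>y. exp (- (t - \<theta>0) * mean) * exp ((t - \<theta>0) * y))"
    by (intro integrable_mult_right tilt_integrable assms)
  have i2: "integrable N (\<lambda>y. (t - \<theta>0) * (y - mean))"
    by (intro integrable_mult_right Bochner_Integration.integrable_diff integrable_id) simp
  have e2: "expectation (\<lambda>y. y - mean) = 0"
    using integrable_id prob_space by (simp add: mean_def)
  show "integrable N (\<lambda>y. exp ((t - \<theta>0) * (y - mean)) - (t - \<theta>0) * (y - mean))"
    unfolding eq by (intro Bochner_Integration.integrable_diff i1 i2)
  have "expectation (\<lambda>y. exp ((t - \<theta>0) * (y - mean)) - (t - \<theta>0) * (y - mean)) =
      exp (- (t - \<theta>0) * mean) * exp (A t - A \<theta>0)"
    unfolding eq by (simp only: Bochner_Integration.integral_diff[OF i1 i2] e2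
        integral_mult_right_zero tilt_expectation[OF assms] mult_zero_right diff_0_right)
  also have "\<dots> = exp (excess t)"
    by (simp add: excess_def exp_add[symmetric] algebra_simps)
  finally show "expectation (\<lambda>y. exp ((t - \<theta>0) * (y - mean)) - (t - \<theta>0) * (y - mean)) = exp (excess t)" .
qed

lemma excess_mono:
  assumes "u \<in> \<Theta>" "t \<in> \<Theta>" and between: "\<theta>0 \<le> u \<and> u \<le> t \<or> t \<le> u \<and> u \<le> \<theta>0"
  shows "excess u \<le> excess t"
proof -
  have "exp ((u - \<theta>0) * z) - (u - \<theta>0) * z \<le> exp ((t - \<theta>0) * z) - (t - \<theta>0) * z" for z
    using between
  proof
    assume "\<theta>0 \<le> u \<and> u \<le> t"
    then show ?thesis by (intro exp_minus_linear_mono) auto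
  next
    assume "t \<le> u \<and> u \<le> \<theta>0"
    then show ?thesis
      using exp_minus_linear_mono[of "\<theta>0 - u" "\<theta>0 - t" "-z"] by (simp add: algebra_simps)
  qed
  then have "exp (excess u) \<le> exp (excess t)"
    unfolding centred_tilt(2)[OF assms(1), symmetric] centred_tilt(2)[OF assms(2), symmetric]
    by (intro integral_mono centred_tilt assms)
  then show ?thesis by simp
qed

lemma \<theta>0_in_params: "\<theta>0 \<in> \<Theta>" using near_in_params[of \<theta>0] \<rho>_pos by simp

lemma excess_nonneg: "t \<in> \<Theta> \<Longrightarrow> 0 \<le> excess t"
  using excess_mono[OF \<theta>0_in_params, of t] linear[of \<theta>0 t] by (auto simp: excess_def)

text \<open>
  The integrand of \<open>centred_tilt\<close> is at least \<open>1\<close>, with equality only where \<open>y = mean\<close>. Equality in the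
  integral would make \<open>N\<close> degenerate.
\<close>

lemma excess_pos:
  assumes t: "t \<in> \<Theta>" "t \<noteq> \<theta>0"
  shows "0 < excess t"
proof (rule ccontr)
  assume "\<not> 0 < excess t"
  with excess_nonneg[OF t(1)] have "excess t = 0" by simp
  let ?g = "\<lambda>y. exp ((t - \<theta>0) * (y - mean)) - (t - \<theta>0) * (y - mean) - 1"
  have int: "integrable N ?g"
    by (intro Bochner_Integration.integrable_diff[OF centred_tilt(1)[OF t(1)]]) simp
  have "expectation ?g = exp (excess t) - 1"
    using Bochner_Integration.integral_diff[OF centred_tilt(1)[OF t(1)], of "\<lambda>_. 1"]
      centred_tilt(2)[OF t(1)] prob_space by simp
  then have "expectation ?g = 0" using \<open>excess t = 0\<close> by simp
  moreover have "0 \<le> ?g y" for y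
    using exp_ge_add_one_self[of "(t - \<theta>0) * (y - mean)"] by linarith
  ultimately have "AE y in N. ?g y = 0"
    using integral_nonneg_eq_0_iff_AE[OF int] by simp
  then have "AE y in N. y = mean"
  proof (rule AE_mp, intro AE_I2 impI)
    fix y assume g: "?g y = 0"
    let ?z = "(t - \<theta>0) * (y - mean)"
    have "exp ?z = 1" using ln_eq_minus_one[of "exp ?z"] g by simp
    then show "y = mean" using t(2) by simp
  qed
  then show False using nondegenerate by blast
qed

text \<open>
  By monotonicity on either side, the divergence outside a neighbourhood of \<open>\<theta>0\<close> is at least its value at
  two points close to \<open>\<theta>0\<close>.
\<close>

lemma excess_separated:
  assumes "0 < r"
  obtains d where "0 < d" "\<And>t. t \<in> \<Theta> \<Longrightarrow> r \<le> \<bar>t - \<theta>0\<bar> \<Longrightarrow> d \<le> excess t"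
proof -
  \<comment> \<open>A radius at which both comparison points are certain to lie in \<open>\<Theta>\<close>.\<close>
  define u where "u = min r (\<rho> / 2)"
  have u: "0 < u" "u < \<rho>" "u \<le> r" using assms \<rho>_pos by (auto simp: u_def)
  have mem: "\<theta>0 + u \<in> \<Theta>" "\<theta>0 - u \<in> \<Theta>" using u by (auto intro!: near_in_params)
  show thesis
  proof
    show "0 < min (excess (\<theta>0 + u)) (excess (\<theta>0 - u))"
      using excess_pos[OF mem(1)] excess_pos[OF mem(2)] u by simp
    fix t assume t: "t \<in> \<Theta>" "r \<le> \<bar>t - \<theta>0\<bar>"
    show "min (excess (\<theta>0 + u)) (excess (\<theta>0 - u)) \<le> excess t"
    proof (cases "\<theta>0 \<le> t")
      case True
      then show ?thesis using excess_mono[OF mem(1) t(1)] t(2) u by (auto simp: min_le_iff_disj)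
    next
      case False
      then show ?thesis using excess_mono[OF mem(2) t(1)] t(2) u by (auto simp: min_le_iff_disj)
    qed
  qed
qed

text \<open>
  The divergence is nonnegative and monotone on either side of \<open>\<theta>0\<close>, so the extreme points of \<open>\<Theta>\<close>
  bound it, and \<open>A\<close> differs from it by an affine function.
\<close>

lemma A_bounded:
  obtains c where "\<And>t. t \<in> \<Theta> \<Longrightarrow> \<bar>A t\<bar> \<le> c"
proof -
  have ne: "\<Theta> \<noteq> {}" using \<theta>0_in_params by blast
  obtain lo hi where lo: "lo \<in> \<Theta>" "\<And>t. t \<in> \<Theta> \<Longrightarrow> lo \<le> t" and hi: "hi \<in> \<Theta>" "\<And>t. t \<in> \<Theta> \<Longrightarrow> t \<le> hi"
    using compact_attains_inf[OF compact_params ne] compact_attains_sup[OF compact_params ne] by metis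
  let ?c = "max (excess lo) (excess hi)"
  have exc: "\<bar>excess t\<bar> \<le> ?c" if "t \<in> \<Theta>" for t
    using excess_nonneg[OF that] excess_mono[OF that hi(1)] excess_mono[OF that lo(1)]
      lo(2)[OF that] hi(2)[OF that] by (cases "\<theta>0 \<le> t") (auto simp: le_max_iff_disj)
  let ?r = "max \<bar>lo - \<theta>0\<bar> \<bar>hi - \<theta>0\<bar>"
  have "\<bar>A t\<bar> \<le> ?c + \<bar>A \<theta>0\<bar> + ?r * \<bar>mean\<bar>" if "t \<in> \<Theta>" for t
  proof -
    have "\<bar>t - \<theta>0\<bar> \<le> ?r" using lo(2)[OF that] hi(2)[OF that] by linarith
    then have "\<bar>(t - \<theta>0) * mean\<bar> \<le> ?r * \<bar>mean\<bar>"
      unfolding abs_mult by (intro mult_right_mono) auto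
    moreover have "A t = excess t + A \<theta>0 + (t - \<theta>0) * mean" by (simp add: excess_def)
    ultimately show ?thesis using exc[OF that] by linarith
  qed
  then show thesis by (rule that)
qed

lemma uniform_bound:
  obtains C where "1 \<le> C" "\<And>t. t \<in> \<Theta> \<Longrightarrow> \<bar>t\<bar> \<le> C" "\<And>t. t \<in> \<Theta> \<Longrightarrow> \<bar>A t\<bar> \<le> C"
    "\<And>t. \<bar>t - \<theta>0\<bar> \<le> \<rho> / 2 \<Longrightarrow> \<bar>A1 t\<bar> \<le> C" "\<And>t. \<bar>t - \<theta>0\<bar> \<le> \<rho> / 2 \<Longrightarrow> \<bar>A2 t\<bar> \<le> C"
proof -
  obtain c1 where c1: "\<And>t. t \<in> \<Theta> \<Longrightarrow> \<bar>t\<bar> \<le> c1"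
    using compact_imp_bounded[OF compact_params] by (auto simp: bounded_iff)
  obtain c2 where c2: "\<And>t. t \<in> \<Theta> \<Longrightarrow> \<bar>A t\<bar> \<le> c2" using A_bounded by blast
  have near: "\<bar>t - \<theta>0\<bar> < \<rho>" if "t \<in> cball \<theta>0 (\<rho> / 2)" for t
    using that \<rho>_pos by (auto simp: dist_real_def abs_minus_commute)
  have "compact (A1 ` cball \<theta>0 (\<rho> / 2))" "compact (A2 ` cball \<theta>0 (\<rho> / 2))"
    by (intro compact_continuous_image compact_cball continuous_at_imp_continuous_on ballI
        isCont_A1 isCont_A2 near; assumption)+
  then obtain c3 c4 where c34: "\<And>t. t \<in> cball \<theta>0 (\<rho> / 2) \<Longrightarrow> \<bar>A1 t\<bar> \<le> c3"
    "\<And>t. t \<in> cball \<theta>0 (\<rho> / 2) \<Longrightarrow> \<bar>A2 t\<bar> \<le> c4"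
    using compact_imp_bounded by (fastforce simp: bounded_iff)
  show thesis
  proof (rule that[of "Max {1, c1, c2, c3, c4}"])
  qed (use c1 c2 c34 in \<open>auto simp: le_max_iff_disj dist_real_def abs_minus_commute\<close>)
qed

text \<open>
  A common integrable bound, up to the factor \<open>\<bar>1 - q\<bar>\<close>, for the errors made by replacing Lq-likelihood and
  Lq-score by likelihood and score.
\<close>

definition envelope :: "real \<Rightarrow> real \<Rightarrow> real" where
  "envelope C y = C\<^sup>2 * (1 + \<bar>y\<bar>)\<^sup>2 * exp (\<rho> / 2 * (1 + \<bar>y\<bar>))"

lemma integrable_envelope_fun: "integrable N (envelope C)"
proof -
  have "envelope C y = (C\<^sup>2 * exp (\<rho> / 2)) * ((1 + \<bar>y\<bar>)\<^sup>2 * exp (0 * y + \<rho> / 2 * \<bar>y\<bar>))" for y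
    by (simp add: envelope_def exp_add[symmetric] algebra_simps)
  then have "envelope C = (\<lambda>y. (C\<^sup>2 * exp (\<rho> / 2)) * ((1 + \<bar>y\<bar>)\<^sup>2 * exp (0 * y + \<rho> / 2 * \<bar>y\<bar>)))" by blast
  then show ?thesis
    using integrable_envelope[of 0 "\<rho> / 2" 2] \<rho>_pos by simp
qed

end

section \<open>Consistency and asymptotic linearity of the estimator\<close>

lemma Lq_exp: "Lq q (exp l) = (if q = 1 then l else (exp ((1 - q) * l) - 1) / (1 - q))"
  by (simp add: Lq_def exp_powr_real mult.commute)

text \<open>
  To first order in \<open>1 - q\<close> the function \<open>Lq q\<close> is the logarithm.
\<close>

lemma Lq_exp_approx: "\<bar>Lq q (exp l) - l\<bar> \<le> \<bar>1 - q\<bar> * (l\<^sup>2 * exp (\<bar>1 - q\<bar> * \<bar>l\<bar>))"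
proof (cases "q = 1")
  case True
  then show ?thesis by (simp add: Lq_exp)
next
  case False
  define e where "e = 1 - q"
  let ?e = e
  have e: "?e \<noteq> 0" "1 - q = ?e" using False by (simp_all add: e_def)
  have sq: "(?e * l)\<^sup>2 = \<bar>?e\<bar> * (\<bar>?e\<bar> * l\<^sup>2)"
    by (simp add: power_mult_distrib power2_eq_square mult.assoc[symmetric])
  have "Lq q (exp l) - l = (exp (?e * l) - 1 - ?e * l) / ?e"
    using False e(1) by (simp add: Lq_exp e(2) field_simps)
  then have "\<bar>Lq q (exp l) - l\<bar> = \<bar>exp (?e * l) - 1 - ?e * l\<bar> / \<bar>?e\<bar>"
    by (simp add: abs_divide)
  also have "\<dots> \<le> ((?e * l)\<^sup>2 * exp \<bar>?e * l\<bar>) / \<bar>?e\<bar>"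
    by (intro divide_right_mono abs_exp_minus_linear_le) auto
  also have "\<dots> = \<bar>?e\<bar> * (l\<^sup>2 * exp (\<bar>?e\<bar> * \<bar>l\<bar>))"
    unfolding sq using e(1) by (simp add: abs_mult)
  finally show ?thesis unfolding e(2) .
qed

lemma DERIV_Lq_exp:
  assumes "(l has_real_derivative l') (at t)"
  shows "((\<lambda>t. Lq q (exp (l t))) has_real_derivative exp ((1 - q) * l t) * l') (at t)"
proof (cases "q = 1")
  case True
  then show ?thesis using assms by (simp add: Lq_exp)
next
  case False
  then have eq: "(\<lambda>t. Lq q (exp (l t))) = (\<lambda>t. (exp ((1 - q) * l t) - 1) / (1 - q))"
    by (simp add: Lq_exp)
  show ?thesis
    unfolding eq using False by (auto intro!: derivative_eq_intros assms)
qed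

text \<open>
  Expressed in the sufficient statistic: the log-density at the observation \<open>Y i\<close> is
  \<open>t * Y i - A t\<close>. The sample is indexed from \<open>0\<close>.
\<close>

locale mlqe_sample = iid_sample M Y N + cumulant_family N A \<Theta> \<theta>0
  for M :: "'a measure" and Y N A \<Theta> \<theta>0 +
  fixes q :: "nat \<Rightarrow> real" and \<theta>t :: "nat \<Rightarrow> 'a \<Rightarrow> real"
  assumes q_pos: "\<And>n. 0 < q n" and q_lim: "q \<longlonglongrightarrow> 1"
    and estimator: "\<And>n \<omega>. 1 \<le> n \<Longrightarrow> \<omega> \<in> space M \<Longrightarrow>
      is_arg_max (\<lambda>t. \<Sum>i<n. Lq (q n) (exp (t * Y i \<omega> - A t))) (\<lambda>t. t \<in> \<Theta>) (\<theta>t n \<omega>)"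
begin

abbreviation \<epsilon> :: "nat \<Rightarrow> real" where "\<epsilon> n \<equiv> 1 - q n"
abbreviation avg :: "(real \<Rightarrow> real) \<Rightarrow> nat \<Rightarrow> 'a \<Rightarrow> real" where
  "avg g n \<omega> \<equiv> (\<Sum>i<n. g (Y i \<omega>)) / real n"
abbreviation \<theta>s :: "nat \<Rightarrow> real" where "\<theta>s n \<equiv> \<theta>0 / q n"

lemma \<epsilon>_lim: "(\<lambda>n. \<bar>\<epsilon> n\<bar>) \<longlonglongrightarrow> 0"
  using tendsto_diff[OF tendsto_const[of 1] q_lim] by (intro tendsto_rabs_zero) simp

lemma \<theta>s_lim: "\<theta>s \<longlonglongrightarrow> \<theta>0"
  using tendsto_divide[OF tendsto_const[of \<theta>0] q_lim] by simp

lemma eventually_\<epsilon>_small: "\<forall>\<^sub>F n in sequentially. \<bar>\<epsilon> n\<bar> * C \<le> \<rho> / 2"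
proof -
  have "(\<lambda>n. \<bar>\<epsilon> n\<bar> * C) \<longlonglongrightarrow> 0" using tendsto_mult_left_zero[OF \<epsilon>_lim] .
  then have "\<forall>\<^sub>F n in sequentially. \<bar>\<epsilon> n\<bar> * C < \<rho> / 2"
    by (rule order_tendstoD) (use \<rho>_pos in simp)
  then show ?thesis by eventually_elim simp
qed

lemma estimator_in_params: "1 \<le> n \<Longrightarrow> \<omega> \<in> space M \<Longrightarrow> \<theta>t n \<omega> \<in> \<Theta>"
  using estimator[of n \<omega>] by (simp add: is_arg_max_linorder)

lemma estimator_max:
  "1 \<le> n \<Longrightarrow> \<omega> \<in> space M \<Longrightarrow> t \<in> \<Theta> \<Longrightarrow>
    (\<Sum>i<n. Lq (q n) (exp (t * Y i \<omega> - A t))) \<le>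
    (\<Sum>i<n. Lq (q n) (exp (\<theta>t n \<omega> * Y i \<omega> - A (\<theta>t n \<omega>))))"
  using estimator[of n \<omega>] by (simp add: is_arg_max_linorder)

lemma avg_mono_abs:
  assumes "\<And>y. \<bar>f y\<bar> \<le> g y"
  shows "\<bar>avg f n \<omega>\<bar> \<le> avg g n \<omega>"
proof -
  have "\<bar>\<Sum>i<n. f (Y i \<omega>)\<bar> \<le> (\<Sum>i<n. \<bar>f (Y i \<omega>)\<bar>)" by (rule sum_abs)
  also have "\<dots> \<le> (\<Sum>i<n. g (Y i \<omega>))" by (intro sum_mono assms)
  finally show ?thesis by (simp add: abs_divide divide_right_mono)
qed

text \<open>
  The error is bounded uniformly in \<open>t\<close> by a single average, so a uniform law of large numbers
  over \<open>\<Theta>\<close> reduces to Markov's inequality for that average.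
\<close>

lemma likelihood_approx:
  assumes C: "1 \<le> C" "\<bar>t\<bar> \<le> C" "\<bar>A t\<bar> \<le> C" and small: "\<bar>\<epsilon> n\<bar> * C \<le> \<rho> / 2" and n: "1 \<le> n"
  shows "\<bar>avg (\<lambda>y. Lq (q n) (exp (t * y - A t))) n \<omega> - (t * avg (\<lambda>y. y) n \<omega> - A t)\<bar>
    \<le> \<bar>\<epsilon> n\<bar> * avg (envelope C) n \<omega>"
proof -
  let ?f = "\<lambda>y. Lq (q n) (exp (t * y - A t)) - (t * y - A t)"
  have "\<bar>?f y\<bar> \<le> \<bar>\<epsilon> n\<bar> * envelope C y" for y
  proof -
    have "\<bar>t * y - A t\<bar> \<le> \<bar>t\<bar> * \<bar>y\<bar> + \<bar>A t\<bar>"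
      using abs_triangle_ineq4[of "t * y" "A t"] by (simp add: abs_mult)
    also have "\<dots> \<le> C * \<bar>y\<bar> + C" using C by (intro add_mono mult_right_mono) auto
    finally have l: "\<bar>t * y - A t\<bar> \<le> C * (1 + \<bar>y\<bar>)" by (simp add: algebra_simps)
    have "\<bar>?f y\<bar> \<le> \<bar>\<epsilon> n\<bar> * ((t * y - A t)\<^sup>2 * exp (\<bar>\<epsilon> n\<bar> * \<bar>t * y - A t\<bar>))"
      by (rule Lq_exp_approx)
    also have "\<dots> \<le> \<bar>\<epsilon> n\<bar> * ((C * (1 + \<bar>y\<bar>))\<^sup>2 * exp (\<rho> / 2 * (1 + \<bar>y\<bar>)))"
    proof (rule mult_left_mono, rule mult_mono, goal_cases)
      case 1
      show "(t * y - A t)\<^sup>2 \<le> (C * (1 + \<bar>y\<bar>))\<^sup>2"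
        using l C(1) by (intro power2_le_iff_abs_le[THEN iffD2]) auto
    next
      case 2
      have "\<bar>\<epsilon> n\<bar> * \<bar>t * y - A t\<bar> \<le> \<bar>\<epsilon> n\<bar> * (C * (1 + \<bar>y\<bar>))"
        using l by (intro mult_left_mono) auto
      also have "\<dots> \<le> \<rho> / 2 * (1 + \<bar>y\<bar>)"
        unfolding mult.assoc[symmetric] using small by (intro mult_right_mono) auto
      finally show ?case by simp
    qed auto
    finally show ?thesis by (simp add: envelope_def power_mult_distrib)
  qed
  then have "\<bar>avg ?f n \<omega>\<bar> \<le> avg (\<lambda>y. \<bar>\<epsilon> n\<bar> * envelope C y) n \<omega>" by (rule avg_mono_abs)
  moreover have "avg ?f n \<omega> = avg (\<lambda>y. Lq (q n) (exp (t * y - A t))) n \<omega> - (t * avg (\<lambda>y. y) n \<omega> - A t)"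
    using n by (simp add: sum_subtractf sum_distrib_left[symmetric] diff_divide_distrib)
  ultimately show ?thesis by (simp add: sum_distrib_left[symmetric])
qed

text \<open>
  Comparing the Lq-likelihood at the maximiser with that at \<open>\<theta>0\<close> bounds the divergence at the
  maximiser by twice the approximation error plus the fluctuation of the sample mean.
\<close>

lemma estimator_consistent: "((\<lambda>p. \<theta>t (fst p) (snd p)) \<longlongrightarrow> \<theta>0) (in_prob M)"
proof (rule tendstoI)
  fix r :: real assume r: "0 < r"
  obtain d where d: "0 < d" "\<And>t. t \<in> \<Theta> \<Longrightarrow> r \<le> \<bar>t - \<theta>0\<bar> \<Longrightarrow> d \<le> excess t"
    using excess_separated[OF r] by blast
  obtain C where C: "1 \<le> C" "\<And>t. t \<in> \<Theta> \<Longrightarrow> \<bar>t\<bar> \<le> C" "\<And>t. t \<in> \<Theta> \<Longrightarrow> \<bar>A t\<bar> \<le> C"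
    by (rule uniform_bound) (rule that; blast)
  have "((\<lambda>p. \<bar>\<epsilon> (fst p)\<bar> * avg (envelope C) (fst p) (snd p)) \<longlongrightarrow> 0) (in_prob M)"
    by (rule average_in_prob_0[OF integrable_envelope_fun \<epsilon>_lim])
  then have e1: "\<forall>\<^sub>F p in in_prob M. \<bar>\<epsilon> (fst p)\<bar> * avg (envelope C) (fst p) (snd p) < d / 8"
    by (rule order_tendstoD) (use d in simp)
  have e2: "\<forall>\<^sub>F p in in_prob M. dist (avg (\<lambda>y. y) (fst p) (snd p)) mean < d / (8 * C)"
    using weak_law_of_large_numbers[OF integrable_square] d C(1) unfolding mean_def
    by (intro tendstoD) auto
  show "\<forall>\<^sub>F p in in_prob M. dist (\<theta>t (fst p) (snd p)) \<theta>0 < r"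
    using e1 e2 eventually_snd_in_prob eventually_fst_in_prob[OF eventually_ge_at_top[of 1]]
      eventually_fst_in_prob[OF eventually_\<epsilon>_small[of C]]
  proof eventually_elim
    case (elim p)
    obtain n \<omega> where p: "p = (n, \<omega>)" by force
    note elim = elim[unfolded p fst_conv snd_conv]
    let ?t = "\<theta>t n \<omega>" and ?y = "avg (\<lambda>y. y) n \<omega>" and ?K = "avg (envelope C) n \<omega>"
    let ?h = "\<lambda>t. avg (\<lambda>y. Lq (q n) (exp (t * y - A t))) n \<omega>"
    have t: "?t \<in> \<Theta>" using elim estimator_in_params by blast
    have "?h \<theta>0 \<le> ?h ?t"
      using estimator_max[of n \<omega> \<theta>0] elim \<theta>0_in_params by (intro divide_right_mono) auto
    moreover have "\<bar>?h \<theta>0 - (\<theta>0 * ?y - A \<theta>0)\<bar> \<le> \<bar>\<epsilon> n\<bar> * ?K"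
      using likelihood_approx[of C \<theta>0 n \<omega>] C \<theta>0_in_params elim by blast
    moreover have "\<bar>?h ?t - (?t * ?y - A ?t)\<bar> \<le> \<bar>\<epsilon> n\<bar> * ?K"
      using likelihood_approx[of C ?t n \<omega>] C t elim by blast
    ultimately have "\<theta>0 * ?y - A \<theta>0 \<le> ?t * ?y - A ?t + d / 4"
      using elim(1) by linarith
    moreover have "excess ?t \<le> (?t - \<theta>0) * (z - mean) + d / 4"
      if "\<theta>0 * z - A \<theta>0 \<le> ?t * z - A ?t + d / 4" for z
      using that by (simp add: excess_def algebra_simps)
    ultimately have "excess ?t \<le> (?t - \<theta>0) * (?y - mean) + d / 4" by blast
    also have "(?t - \<theta>0) * (?y - mean) \<le> (2 * C) * (d / (8 * C))"
    proof -
      have "(?t - \<theta>0) * (?y - mean) \<le> \<bar>?t - \<theta>0\<bar> * \<bar>?y - mean\<bar>"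
        unfolding abs_mult[symmetric] by simp
      also have "\<dots> \<le> (2 * C) * (d / (8 * C))"
        using C(2)[OF t] C(2)[OF \<theta>0_in_params] elim(2) by (intro mult_mono) (auto simp: dist_real_def)
      finally show ?thesis .
    qed
    also have "(2 * C) * (d / (8 * C)) = d / 4" using C(1) by simp
    finally have "excess ?t < d" using d(1) by simp
    then show ?case using d(2)[OF t] by (force simp: p dist_real_def)
  qed
qed

text \<open>
  The average of the modified scores at \<open>t\<close>, divided by the common positive factor
  \<open>exp (- \<epsilon> n * A t)\<close>, which does not affect its zeros.
\<close>

definition score :: "nat \<Rightarrow> 'a \<Rightarrow> real \<Rightarrow> real" where
  "score n \<omega> t = avg (\<lambda>y. exp (\<epsilon> n * t * y) * (y - A1 t)) n \<omega>"

lemma score_estimator: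
  assumes n: "1 \<le> n" and \<omega>: "\<omega> \<in> space M" and near: "\<bar>\<theta>t n \<omega> - \<theta>0\<bar> < \<rho>"
  shows "score n \<omega> (\<theta>t n \<omega>) = 0"
proof -
  let ?t = "\<theta>t n \<omega>"
  let ?l = "\<lambda>i t. t * Y i \<omega> - A t"
  have "((\<lambda>t. \<Sum>i<n. Lq (q n) (exp (?l i t))) has_real_derivative
      (\<Sum>i<n. exp (\<epsilon> n * ?l i ?t) * (Y i \<omega> - A1 ?t))) (at ?t)"
    by (intro DERIV_sum DERIV_Lq_exp) (auto intro!: derivative_eq_intros DERIV_A near)
  then have "(\<Sum>i<n. exp (\<epsilon> n * ?l i ?t) * (Y i \<omega> - A1 ?t)) = 0"
  proof (rule DERIV_local_max)
    show "0 < \<rho> - \<bar>?t - \<theta>0\<bar>" using near by simp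
    show "\<forall>t. \<bar>?t - t\<bar> < \<rho> - \<bar>?t - \<theta>0\<bar> \<longrightarrow>
        (\<Sum>i<n. Lq (q n) (exp (?l i t))) \<le> (\<Sum>i<n. Lq (q n) (exp (?l i ?t)))"
    proof (intro allI impI)
      fix t assume "\<bar>?t - t\<bar> < \<rho> - \<bar>?t - \<theta>0\<bar>"
      then have "\<bar>t - \<theta>0\<bar> < \<rho>" by linarith
      from estimator_max[OF n \<omega> near_in_params[OF this]]
      show "(\<Sum>i<n. Lq (q n) (exp (?l i t))) \<le> (\<Sum>i<n. Lq (q n) (exp (?l i ?t)))" .
    qed
  qed
  moreover have "exp (\<epsilon> n * ?l i ?t) = exp (- \<epsilon> n * A ?t) * exp (\<epsilon> n * ?t * Y i \<omega>)" for i
    unfolding exp_add[symmetric] by (simp add: algebra_simps)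
  then have "(\<Sum>i<n. exp (\<epsilon> n * ?l i ?t) * (Y i \<omega> - A1 ?t)) =
      exp (- \<epsilon> n * A ?t) * (\<Sum>i<n. exp (\<epsilon> n * ?t * Y i \<omega>) * (Y i \<omega> - A1 ?t))"
    by (simp only: sum_distrib_left mult.assoc)
  ultimately show ?thesis by (simp add: score_def)
qed

definition score_deriv :: "nat \<Rightarrow> 'a \<Rightarrow> real \<Rightarrow> real" where
  "score_deriv n \<omega> t =
    avg (\<lambda>y. exp (\<epsilon> n * t * y) * (\<epsilon> n * y * (y - A1 t) - A2 t)) n \<omega>"

lemma DERIV_score:
  assumes "\<bar>t - \<theta>0\<bar> < \<rho>"
  shows "(score n \<omega> has_real_derivative score_deriv n \<omega> t) (at t)"
  unfolding score_def[abs_def] score_deriv_def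
  by (intro DERIV_cdivide DERIV_sum)
    (auto intro!: derivative_eq_intros DERIV_A1 assms simp: algebra_simps)

lemma score_deriv_approx:
  assumes C: "1 \<le> C" "\<bar>t\<bar> \<le> C" "\<bar>A1 t\<bar> \<le> C" "\<bar>A2 t\<bar> \<le> C"
    and small: "\<bar>\<epsilon> n\<bar> * C \<le> \<rho> / 2" and n: "1 \<le> n"
  shows "\<bar>score_deriv n \<omega> t + A2 t\<bar> \<le> 2 * (\<bar>\<epsilon> n\<bar> * avg (envelope C) n \<omega>)"
proof -
  let ?f = "\<lambda>y. exp (\<epsilon> n * t * y) * (\<epsilon> n * y * (y - A1 t) - A2 t) + A2 t"
  have "\<bar>?f y\<bar> \<le> 2 * (\<bar>\<epsilon> n\<bar> * envelope C y)" for y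
  proof -
    let ?u = "1 + \<bar>y\<bar>" and ?E = "exp (\<rho> / 2 * (1 + \<bar>y\<bar>))"
    have "\<bar>\<epsilon> n * t * y\<bar> = (\<bar>\<epsilon> n\<bar> * \<bar>t\<bar>) * \<bar>y\<bar>" by (simp add: abs_mult)
    also have "\<dots> \<le> (\<bar>\<epsilon> n\<bar> * C) * ?u" using C by (intro mult_mono) auto
    finally have z: "\<bar>\<epsilon> n * t * y\<bar> \<le> \<bar>\<epsilon> n\<bar> * C * ?u" .
    also have "\<dots> \<le> \<rho> / 2 * ?u" using small by (intro mult_right_mono) auto
    finally have z2: "\<bar>\<epsilon> n * t * y\<bar> \<le> \<rho> / 2 * ?u" .
    have E: "exp (\<epsilon> n * t * y) \<le> ?E" using z2 by simp
    have u: "?u \<le> ?u\<^sup>2" by (rule self_le_power) auto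
    have CC: "C \<le> C\<^sup>2" using C(1) by (intro self_le_power) auto
    have a: "\<bar>exp (\<epsilon> n * t * y) * (\<epsilon> n * y * (y - A1 t))\<bar> \<le> \<bar>\<epsilon> n\<bar> * envelope C y"
    proof -
      have "\<bar>y - A1 t\<bar> \<le> \<bar>y\<bar> + C" using C(3) abs_triangle_ineq4[of y "A1 t"] by linarith
      also have "\<dots> \<le> C * ?u" using C(1) by (simp add: algebra_simps mult_le_cancel_right1)
      finally have "\<bar>y\<bar> * \<bar>y - A1 t\<bar> \<le> ?u * (C * ?u)" by (intro mult_mono) auto
      also have "\<dots> = C * ?u\<^sup>2" by (simp add: power2_eq_square)
      also have "\<dots> \<le> C\<^sup>2 * ?u\<^sup>2" using CC by (intro mult_right_mono) auto
      finally have "\<bar>y\<bar> * \<bar>y - A1 t\<bar> \<le> C\<^sup>2 * ?u\<^sup>2" .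
      then have "\<bar>\<epsilon> n\<bar> * (\<bar>y\<bar> * \<bar>y - A1 t\<bar> * exp (\<epsilon> n * t * y)) \<le> \<bar>\<epsilon> n\<bar> * (C\<^sup>2 * ?u\<^sup>2 * ?E)"
        by (intro mult_left_mono[OF mult_mono[OF _ E]]) auto
      then show ?thesis by (simp add: envelope_def abs_mult mult_ac)
    qed
    have b: "\<bar>(1 - exp (\<epsilon> n * t * y)) * A2 t\<bar> \<le> \<bar>\<epsilon> n\<bar> * envelope C y"
    proof -
      have "\<bar>1 - exp (\<epsilon> n * t * y)\<bar> \<le> \<bar>\<epsilon> n * t * y\<bar> * exp \<bar>\<epsilon> n * t * y\<bar>"
        using abs_exp_minus_1_le[of "\<epsilon> n * t * y"] by (simp add: abs_minus_commute)
      also have "\<dots> \<le> (\<bar>\<epsilon> n\<bar> * C * ?u) * ?E"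
        using z z2 C(1) by (intro mult_mono) auto
      finally have "\<bar>1 - exp (\<epsilon> n * t * y)\<bar> * \<bar>A2 t\<bar> \<le> ((\<bar>\<epsilon> n\<bar> * C * ?u) * ?E) * C"
        using C by (intro mult_mono) auto
      also have "\<dots> = \<bar>\<epsilon> n\<bar> * (C\<^sup>2 * ?u * ?E)" by (simp add: power2_eq_square)
      also have "\<dots> \<le> \<bar>\<epsilon> n\<bar> * envelope C y"
        unfolding envelope_def using u by (intro mult_left_mono mult_right_mono) auto
      finally show ?thesis by (simp add: abs_mult)
    qed
    have "?f y = exp (\<epsilon> n * t * y) * (\<epsilon> n * y * (y - A1 t)) + (1 - exp (\<epsilon> n * t * y)) * A2 t"
      by (simp add: algebra_simps)
    then have "\<bar>?f y\<bar> \<le> \<bar>exp (\<epsilon> n * t * y) * (\<epsilon> n * y * (y - A1 t))\<bar> + \<bar>(1 - exp (\<epsilon> n * t * y)) * A2 t\<bar>"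
      by (simp only: abs_triangle_ineq)
    then show ?thesis using a b by linarith
  qed
  then have "\<bar>avg ?f n \<omega>\<bar> \<le> avg (\<lambda>y. 2 * (\<bar>\<epsilon> n\<bar> * envelope C y)) n \<omega>" by (rule avg_mono_abs)
  moreover have "avg ?f n \<omega> = score_deriv n \<omega> t + A2 t"
    using n by (simp add: score_deriv_def sum.distrib add_divide_distrib)
  ultimately show ?thesis by (simp add: sum_distrib_left[symmetric])
qed

text \<open>
  Where the estimator is a zero of the score, this is the slope of the chord of \<open>- score\<close> between the
  surrogate parameter and the estimator. Coinciding end points get the value of the limit.
\<close>

definition slope :: "nat \<Rightarrow> 'a \<Rightarrow> real" where
  "slope n \<omega> = (if \<theta>t n \<omega> = \<theta>s n then var else score n \<omega> (\<theta>s n) / (\<theta>t n \<omega> - \<theta>s n))"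

text \<open>
  By the mean value theorem the slope is the negated derivative of the score at a point between the surrogate
  parameter and the estimator. Both tend to \<open>\<theta>0\<close>, and the derivative is uniformly close to \<open>- A2\<close>.
\<close>

lemma slope_in_prob: "((\<lambda>p. slope (fst p) (snd p)) \<longlongrightarrow> var) (in_prob M)"
proof (rule tendstoI)
  fix e :: real assume e: "0 < e"
  obtain C where C: "1 \<le> C" "\<And>t. t \<in> \<Theta> \<Longrightarrow> \<bar>t\<bar> \<le> C"
    "\<And>t. \<bar>t - \<theta>0\<bar> \<le> \<rho> / 2 \<Longrightarrow> \<bar>A1 t\<bar> \<le> C" "\<And>t. \<bar>t - \<theta>0\<bar> \<le> \<rho> / 2 \<Longrightarrow> \<bar>A2 t\<bar> \<le> C"
    by (rule uniform_bound) (rule that; blast)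
  have "isCont A2 \<theta>0" using isCont_A2[of \<theta>0] \<rho>_pos by simp
  then have "\<exists>s>0. \<forall>t. dist t \<theta>0 < s \<longrightarrow> dist (A2 t) (A2 \<theta>0) < e / 2"
    using half_gt_zero[OF e] unfolding continuous_at_eps_delta by blast
  then obtain s where s: "0 < s" "\<And>t. \<bar>t - \<theta>0\<bar> < s \<Longrightarrow> \<bar>A2 t - var\<bar> < e / 2"
    unfolding A2_\<theta>0 dist_real_def by blast
  define r where "r = min s (\<rho> / 2)"
  have r: "0 < r" "r \<le> s" "r \<le> \<rho> / 2" "r < \<rho>" using s \<rho>_pos by (auto simp: r_def)
  have "((\<lambda>p. \<bar>\<epsilon> (fst p)\<bar> * avg (envelope C) (fst p) (snd p)) \<longlongrightarrow> 0) (in_prob M)"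
    by (rule average_in_prob_0[OF integrable_envelope_fun \<epsilon>_lim])
  then have e1: "\<forall>\<^sub>F p in in_prob M. \<bar>\<epsilon> (fst p)\<bar> * avg (envelope C) (fst p) (snd p) < e / 4"
    by (rule order_tendstoD) (use e in simp)
  show "\<forall>\<^sub>F p in in_prob M. dist (slope (fst p) (snd p)) var < e"
    using e1 tendstoD[OF estimator_consistent r(1)]
      eventually_fst_in_prob[OF tendstoD[OF \<theta>s_lim r(1)]]
      eventually_snd_in_prob eventually_fst_in_prob[OF eventually_ge_at_top[of 1]]
      eventually_fst_in_prob[OF eventually_\<epsilon>_small[of C]]
  proof eventually_elim
    case (elim p)
    obtain n \<omega> where p: "p = (n, \<omega>)" by force
    note elim = elim[unfolded p fst_conv snd_conv dist_real_def]
    have "\<bar>slope n \<omega> - var\<bar> < e"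
    proof (cases "\<theta>t n \<omega> = \<theta>s n")
      case True
      then show ?thesis using e by (simp add: slope_def)
    next
      case False
      have close: "\<bar>t - \<theta>0\<bar> < r" if "min (\<theta>t n \<omega>) (\<theta>s n) \<le> t" "t \<le> max (\<theta>t n \<omega>) (\<theta>s n)" for t
        using that elim(2,3) by linarith
      obtain z where z: "\<bar>z - \<theta>0\<bar> < r"
        "score n \<omega> (\<theta>t n \<omega>) - score n \<omega> (\<theta>s n) = (\<theta>t n \<omega> - \<theta>s n) * score_deriv n \<omega> z"
      proof (cases "\<theta>t n \<omega> < \<theta>s n")
        case True
        have "\<exists>z>\<theta>t n \<omega>. z < \<theta>s n \<and> score n \<omega> (\<theta>s n) - score n \<omega> (\<theta>t n \<omega>) =
            (\<theta>s n - \<theta>t n \<omega>) * score_deriv n \<omega> z"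
          using True close r by (intro MVT2 DERIV_score) fastforce+
        then obtain z where "\<theta>t n \<omega> < z" "z < \<theta>s n" "score n \<omega> (\<theta>s n) - score n \<omega> (\<theta>t n \<omega>) =
            (\<theta>s n - \<theta>t n \<omega>) * score_deriv n \<omega> z" by blast
        then show ?thesis using True close[of z] by (intro that[of z]) (auto simp: algebra_simps)
      next
        case ge: False
        have "\<exists>z>\<theta>s n. z < \<theta>t n \<omega> \<and> score n \<omega> (\<theta>t n \<omega>) - score n \<omega> (\<theta>s n) =
            (\<theta>t n \<omega> - \<theta>s n) * score_deriv n \<omega> z"
          using ge False close r by (intro MVT2 DERIV_score) fastforce+
        then obtain z where "\<theta>s n < z" "z < \<theta>t n \<omega>" "score n \<omega> (\<theta>t n \<omega>) - score n \<omega> (\<theta>s n) =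
            (\<theta>t n \<omega> - \<theta>s n) * score_deriv n \<omega> z" by blast
        then show ?thesis using ge close[of z] by (intro that[of z]) auto
      qed
      have "score n \<omega> (\<theta>t n \<omega>) = 0" using elim(2,4,5) r by (intro score_estimator) auto
      with z(2) False have "slope n \<omega> = - score_deriv n \<omega> z"
        by (simp add: slope_def field_simps)
      moreover have "\<bar>score_deriv n \<omega> z + A2 z\<bar> \<le> 2 * (\<bar>\<epsilon> n\<bar> * avg (envelope C) n \<omega>)"
        using z(1) r elim(5,6) near_in_params[of z] by (intro score_deriv_approx C) auto
      moreover have "\<bar>A2 z - var\<bar> < e / 2" using z(1) r by (intro s(2)) auto
      ultimately show ?thesis using elim(1) by linarith
    qed
    then show ?case by (simp add: p dist_real_def)
  qed
qed

text \<open>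
  At the surrogate parameter the weight exponent is \<open>\<epsilon> n * (\<theta>0 / q n) = \<theta>0 / q n - \<theta>0\<close>, which tilts the true
  law exactly to the member \<open>\<theta>0 / q n\<close> of the family, under which \<open>Y\<close> has mean \<open>A1 (\<theta>0 / q n)\<close>. Hence the
  summands of the score are centred there, and so is their difference \<open>D n\<close> from \<open>y - mean\<close>, whose variance tends to \<open>0\<close>.
\<close>

lemma score_surrogate:
  "((\<lambda>p. sqrt (real (fst p)) * score (fst p) (snd p) (\<theta>s (fst p)) -
     (\<Sum>i<fst p. Y i (snd p) - mean) / sqrt (real (fst p))) \<longlongrightarrow> 0) (in_prob M)"
proof -
  define a where "a n = \<theta>s n - \<theta>0" for n
  define c where "c n = A1 (\<theta>s n)" for n
  define D where "D n y = exp (a n * y) * (y - c n) - (y - mean)" for n y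
  have a_lim: "a \<longlonglongrightarrow> 0" unfolding a_def using tendsto_diff[OF \<theta>s_lim tendsto_const[of \<theta>0]] by simp
  have c_lim: "c \<longlonglongrightarrow> mean"
    unfolding c_def A1_\<theta>0[symmetric]
    by (rule isCont_tendsto_compose[OF isCont_A1 \<theta>s_lim]) (use \<rho>_pos in simp)
  have small: "\<forall>\<^sub>F n in sequentially. \<bar>a n\<bar> < \<rho> / 2"
    using tendstoD[OF a_lim, of "\<rho> / 2"] \<rho>_pos by (simp add: dist_real_def)
  have m_lim: "(\<lambda>n. mom k (x n)) \<longlonglongrightarrow> mom k 0" if "x \<longlonglongrightarrow> 0" for x k
    by (rule isCont_tendsto_compose[OF isCont_mom_0 that])
  have D1: "N.expectation (D n) = 0" if "\<bar>a n\<bar> < \<rho> / 2" for n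
  proof -
    have eq: "D n y = (- c n + 1 * y + 0 * y\<^sup>2) * exp (a n * y) - (- mean + 1 * y + 0 * y\<^sup>2) * exp (0 * y)" for y
      by (simp add: D_def algebra_simps)
    have "N.expectation (D n) = (mom 1 (a n) - c n * mom 0 (a n)) - (mom 1 0 - mean * mom 0 0)"
      unfolding eq[abs_def]
      using that \<rho>_pos expectation_quadratic_tilted[of "a n" "- c n" 1 0] expectation_quadratic_tilted[of 0 "- mean" 1 0]
      by (subst Bochner_Integration.integral_diff) simp_all
    also have "\<dots> = 0"
      using mom_0_pos[of "a n"] that \<rho>_pos by (simp add: mom_at_0 c_def A1_def a_def)
    finally show ?thesis .
  qed
  \<comment> \<open>The second moment of \<open>D n\<close>, from expanding the square; its three groups tend to \<open>var\<close>, \<open>- 2 * var\<close>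
    and \<open>var\<close>.\<close>
  define v where "v n = ((c n)\<^sup>2 * mom 0 (2 * a n) + (- 2 * c n) * mom 1 (2 * a n) + 1 * mom 2 (2 * a n))
      - 2 * ((mean * c n) * mom 0 (a n) + (- (mean + c n)) * mom 1 (a n) + 1 * mom 2 (a n))
      + (mean\<^sup>2 * mom 0 0 + (- 2 * mean) * mom 1 0 + 1 * mom 2 0)" for n
  have D2: "integrable N (\<lambda>y. (D n y)\<^sup>2) \<and> N.expectation (\<lambda>y. (D n y)\<^sup>2) = v n" if "\<bar>a n\<bar> < \<rho> / 2" for n
  proof -
    have eq: "(D n y)\<^sup>2 = ((c n)\<^sup>2 + (- 2 * c n) * y + 1 * y\<^sup>2) * exp (2 * a n * y)
      - 2 * (((mean * c n) + (- (mean + c n)) * y + 1 * y\<^sup>2) * exp (a n * y))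
      + (mean\<^sup>2 + (- 2 * mean) * y + 1 * y\<^sup>2) * exp (0 * y)" for y
    proof -
      have "exp (2 * a n * y) = exp (a n * y) * exp (a n * y)" by (simp add: exp_add[symmetric])
      then show ?thesis unfolding D_def by (simp add: power2_eq_square algebra_simps)
    qed
    have b: "\<bar>2 * a n\<bar> < \<rho>" "\<bar>a n\<bar> < \<rho>" "\<bar>0\<bar> < \<rho>" using that \<rho>_pos by auto
    note q1 = expectation_quadratic_tilted[OF b(1), of "(c n)\<^sup>2" "- 2 * c n" 1]
    note q2 = expectation_quadratic_tilted[OF b(2), of "mean * c n" "- (mean + c n)" 1]
    note q3 = expectation_quadratic_tilted[OF b(3), of "mean\<^sup>2" "- 2 * mean" 1]
    have q12: "integrable N (\<lambda>y. ((c n)\<^sup>2 + (- 2 * c n) * y + 1 * y\<^sup>2) * exp (2 * a n * y)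
      - 2 * (((mean * c n) + (- (mean + c n)) * y + 1 * y\<^sup>2) * exp (a n * y)))"
      by (intro Bochner_Integration.integrable_diff integrable_mult_right q1(1) q2(1))
    show ?thesis
      unfolding eq v_def
      by (intro conjI Bochner_Integration.integrable_add q12 q3(1))
        (simp only: Bochner_Integration.integral_add[OF q12 q3(1)]
          Bochner_Integration.integral_diff[OF q1(1) integrable_mult_right[OF q2(1)]]
          integral_mult_right_zero q1(2) q2(2) q3(2))
  qed
  have "((\<lambda>p. (\<Sum>i<fst p. D (fst p) (Y i (snd p))) / sqrt (real (fst p))) \<longlongrightarrow> 0) (in_prob M)"
  proof (rule normalized_sum_in_prob_0)
    show "\<forall>\<^sub>F n in sequentially. integrable N (\<lambda>y. (D n y)\<^sup>2)"
      using small by eventually_elim (use D2 in blast)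
    show "\<forall>\<^sub>F n in sequentially. N.expectation (D n) = 0"
      using small by eventually_elim (rule D1)
    have "v \<longlonglongrightarrow> (mean\<^sup>2 * mom 0 0 + (- 2 * mean) * mom 1 0 + 1 * mom 2 0)
      - 2 * ((mean * mean) * mom 0 0 + (- (mean + mean)) * mom 1 0 + 1 * mom 2 0)
      + (mean\<^sup>2 * mom 0 0 + (- 2 * mean) * mom 1 0 + 1 * mom 2 0)"
      unfolding v_def by (intro tendsto_intros m_lim tendsto_mult_right_zero a_lim c_lim)
    then have v_lim: "v \<longlonglongrightarrow> 0" by (simp add: power2_eq_square algebra_simps)
    have "\<forall>\<^sub>F n in sequentially. N.expectation (\<lambda>y. (D n y)\<^sup>2) = v n"
      using small by eventually_elim (use D2 in blast)
    then show "(\<lambda>n. N.expectation (\<lambda>y. (D n y)\<^sup>2)) \<longlonglongrightarrow> 0"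
      using v_lim by (simp add: tendsto_cong)
  qed (simp add: D_def)
  moreover have "\<forall>\<^sub>F p in in_prob M. (\<Sum>i<fst p. D (fst p) (Y i (snd p))) / sqrt (real (fst p)) =
      sqrt (real (fst p)) * score (fst p) (snd p) (\<theta>s (fst p)) - (\<Sum>i<fst p. Y i (snd p) - mean) / sqrt (real (fst p))"
    using eventually_fst_in_prob[OF eventually_gt_at_top[of 0]]
  proof eventually_elim
    case (elim p)
    have "\<epsilon> n * \<theta>s n = a n" for n using q_pos[of n] by (simp add: a_def field_simps)
    then have "score (fst p) (snd p) (\<theta>s (fst p)) = avg (\<lambda>y. exp (a (fst p) * y) * (y - c (fst p))) (fst p) (snd p)"
      by (simp add: score_def c_def)
    moreover have "sqrt (real (fst p)) * (x / real (fst p)) = x / sqrt (real (fst p))" for x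
      using elim by (simp add: field_simps real_sqrt_mult_self)
    ultimately show ?case
      by (simp add: D_def sum_subtractf diff_divide_distrib)
  qed
  ultimately show ?thesis by (simp add: tendsto_cong)
qed

definition std_sum :: "nat \<Rightarrow> 'a \<Rightarrow> real" where
  "std_sum n \<omega> = (\<Sum>i<n. Y i \<omega> - mean) / sqrt (n * var)"

lemma tight_std_sum: "tight_rvs M std_sum"
proof (rule tight_rvs_if_L2_bounded)
  have eq: "(std_sum n \<omega>)\<^sup>2 = ((\<Sum>i<n. Y i \<omega> - mean) / sqrt n)\<^sup>2 / var" for n \<omega>
    using var_pos by (simp add: std_sum_def power_divide)
  have m: "N.expectation (\<lambda>y. y - mean) = 0"
    using integrable_id by (simp add: mean_def)
  note sm = second_moment_normalized_sum[of "\<lambda>y. y - mean", OF _ integrable_var m]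
  show "\<forall>\<^sub>F n in sequentially. integrable M (\<lambda>\<omega>. (std_sum n \<omega>)\<^sup>2)"
    using eventually_gt_at_top[of 0] unfolding eq by eventually_elim (intro integrable_divide sm(1); simp)
  show "\<forall>\<^sub>F n in sequentially. expectation (\<lambda>\<omega>. (std_sum n \<omega>)\<^sup>2) \<le> 1"
    using eventually_gt_at_top[of 0] unfolding eq
    by eventually_elim (use sm(2) var_pos in \<open>simp add: var_def[symmetric]\<close>)
qed

lemma std_sum_clt: "weak_conv_m (\<lambda>n. distr M borel (std_sum n)) std_normal_distribution"
proof -
  have E: "expectation (Y n) = mean" for n
    using expectation_law[of "\<lambda>y. y" n] by (simp add: mean_def)
  have "weak_conv_m (\<lambda>n. distr M borel (\<lambda>x. (\<Sum>i<n. Y i x - mean) / sqrt (n * (sqrt var)\<^sup>2))) std_normal_distribution"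
  proof (rule central_limit_theorem[OF indep E _ _ _ law])
    show "0 < sqrt var" using var_pos by simp
    show "integrable M (\<lambda>x. (Y n x)\<^sup>2)" for n
      using integrable_law_iff[of "\<lambda>y. y\<^sup>2"] integrable_square by simp
    show "variance (Y n) = (sqrt var)\<^sup>2" for n
      using expectation_law[of "\<lambda>y. (y - mean)\<^sup>2" n] var_pos by (simp add: E var_def[symmetric])
  qed
  then show ?thesis using var_pos by (simp add: std_sum_def[abs_def])
qed

text \<open>
  Since \<open>score = slope * (\<theta>t n - \<theta>s n)\<close> at the surrogate parameter, the difference is the standardised sum times
  a factor tending to \<open>0\<close> plus the error of \<open>score_surrogate\<close> divided by a convergent factor.
\<close>

theorem estimator_asymptotically_linear:
  assumes \<sigma>: "\<sigma> \<longlonglongrightarrow> 1 / sqrt var"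
  shows "((\<lambda>p. sqrt (real (fst p)) * (\<theta>t (fst p) (snd p) - \<theta>s (fst p)) / \<sigma> (fst p) - std_sum (fst p) (snd p))
    \<longlongrightarrow> 0) (in_prob M)"
proof -
  let ?L = "\<lambda>p. slope (fst p) (snd p)"
  let ?R = "\<lambda>p. sqrt (real (fst p)) * score (fst p) (snd p) (\<theta>s (fst p)) -
     (\<Sum>i<fst p. Y i (snd p) - mean) / sqrt (real (fst p))"
  have V: "sqrt var > 0" "var > 0" "sqrt var * sqrt var = var" using var_pos by auto
  have L\<sigma>: "((\<lambda>p. ?L p * \<sigma> (fst p)) \<longlongrightarrow> var * (1 / sqrt var)) (in_prob M)"
    by (intro tendsto_mult slope_in_prob tendsto_fst_in_prob \<sigma>)
  have "((\<lambda>p. sqrt var / (?L p * \<sigma> (fst p)) - 1) \<longlongrightarrow> sqrt var / (var * (1 / sqrt var)) - 1) (in_prob M)"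
    using V by (intro tendsto_intros L\<sigma>) auto
  then have "((\<lambda>p. sqrt var / (?L p * \<sigma> (fst p)) - 1) \<longlongrightarrow> 0) (in_prob M)" using V by simp
  from tight_rvs_mult_tendsto_0[OF tight_std_sum this]
  have 1: "((\<lambda>p. std_sum (fst p) (snd p) * (sqrt var / (?L p * \<sigma> (fst p)) - 1)) \<longlongrightarrow> 0) (in_prob M)" .
  have "((\<lambda>p. ?R p / (?L p * \<sigma> (fst p))) \<longlongrightarrow> 0 / (var * (1 / sqrt var))) (in_prob M)"
    using V by (intro tendsto_divide score_surrogate L\<sigma>) auto
  then have lim: "((\<lambda>p. std_sum (fst p) (snd p) * (sqrt var / (?L p * \<sigma> (fst p)) - 1) +
      ?R p / (?L p * \<sigma> (fst p))) \<longlongrightarrow> 0) (in_prob M)"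
    using tendsto_add[OF 1] by simp
  have \<sigma>_pos: "\<forall>\<^sub>F n in sequentially. 0 < \<sigma> n"
    using V by (intro order_tendstoD(1)[OF \<sigma>]) auto
  have "\<forall>\<^sub>F p in in_prob M. std_sum (fst p) (snd p) * (sqrt var / (?L p * \<sigma> (fst p)) - 1) +
      ?R p / (?L p * \<sigma> (fst p)) =
      sqrt (real (fst p)) * (\<theta>t (fst p) (snd p) - \<theta>s (fst p)) / \<sigma> (fst p) - std_sum (fst p) (snd p)"
    using order_tendstoD(1)[OF slope_in_prob V(2)]
      eventually_fst_in_prob[OF \<sigma>_pos]
      tendstoD[OF estimator_consistent \<rho>_pos]
      eventually_snd_in_prob eventually_fst_in_prob[OF eventually_ge_at_top[of 1]]
  proof eventually_elim
    case (elim p)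
    obtain n \<omega> where p: "p = (n, \<omega>)" by force
    note elim = elim[unfolded p fst_conv snd_conv dist_real_def]
    have \<sigma>p: "0 < \<sigma> n" by (rule elim(2))
    have z: "score n \<omega> (\<theta>t n \<omega>) = 0" using elim(3-5) by (intro score_estimator)
    have score: "score n \<omega> (\<theta>s n) = slope n \<omega> * (\<theta>t n \<omega> - \<theta>s n)"
      using z by (auto simp: slope_def)
    have "(\<Sum>i<n. Y i \<omega> - mean) / sqrt n = std_sum n \<omega> * sqrt var"
      using V by (simp add: std_sum_def real_sqrt_mult)
    then show ?case
      using elim(1) \<sigma>p unfolding p fst_conv snd_conv score by (simp add: field_simps)
  qed
  then show ?thesis using lim by (simp add: tendsto_cong)
qed

end

section \<open>The delta method\<close>

lemma taylor_order_2:
  fixes f f1 f2 :: "real \<Rightarrow> real"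
  assumes d1: "\<And>u. \<bar>u - s\<bar> \<le> \<bar>t - s\<bar> \<Longrightarrow> (f has_real_derivative f1 u) (at u)"
    and d2: "\<And>u. \<bar>u - s\<bar> \<le> \<bar>t - s\<bar> \<Longrightarrow> (f1 has_real_derivative f2 u) (at u)"
  obtains z where "\<bar>z - s\<bar> \<le> \<bar>t - s\<bar>" "f t = f s + f1 s * (t - s) + f2 z / 2 * (t - s)\<^sup>2"
proof (cases "t = s")
  case True
  then show thesis by (intro that[of s]) auto
next
  case False
  let ?diff = "\<lambda>m::nat. if m = 0 then f else if m = 1 then f1 else f2" and ?r = "\<bar>t - s\<bar>"
  have "\<exists>z. (if t < s then t < z \<and> z < s else s < z \<and> z < t) \<and>
    f t = (\<Sum>m<2. (?diff m s / fact m) * (t - s) ^ m) + (?diff 2 z / fact 2) * (t - s)\<^sup>2"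
  proof (rule Taylor)
    show "\<forall>m u. m < 2 \<and> s - ?r \<le> u \<and> u \<le> s + ?r \<longrightarrow> (?diff m has_real_derivative ?diff (Suc m) u) (at u)"
    proof (intro allI impI)
      fix m :: nat and u assume *: "m < 2 \<and> s - ?r \<le> u \<and> u \<le> s + ?r"
      then have "\<bar>u - s\<bar> \<le> ?r" by linarith
      with * d1[of u] d2[of u] show "(?diff m has_real_derivative ?diff (Suc m) u) (at u)"
        by (cases "m = 0") (auto simp: less_2_cases_iff)
    qed
  qed (use False in auto)
  then obtain z where "if t < s then t < z \<and> z < s else s < z \<and> z < t"
    "f t = f s + f1 s * (t - s) + f2 z / 2 * (t - s)\<^sup>2"
    by (auto simp: numeral_2_eq_2)
  then show thesis by (intro that[of z]) (auto split: if_splits)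
qed

context mlqe_sample
begin

text \<open>
  The two expectations that make up the scale \<open>\<sigma>\<^sub>n\<close>, with the modified score and its derivative written
  out for parameters near \<open>\<theta>0\<close>.
\<close>

definition score_variance :: "nat \<Rightarrow> real" where
  "score_variance n = N.expectation (\<lambda>y. (exp (\<epsilon> n * (\<theta>s n * y - A (\<theta>s n))) * (y - A1 (\<theta>s n)))\<^sup>2)"

definition score_slope :: "nat \<Rightarrow> real" where
  "score_slope n = N.expectation (\<lambda>y. exp (\<epsilon> n * (\<theta>s n * y - A (\<theta>s n))) *
     (\<epsilon> n * (y - A1 (\<theta>s n))\<^sup>2 - A2 (\<theta>s n)))"

lemma asymptotic_scale: "(\<lambda>n. - sqrt (score_variance n) / score_slope n) \<longlonglongrightarrow> 1 / sqrt var"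
proof -
  define a where "a n = \<theta>s n - \<theta>0" for n
  define c where "c n = A1 (\<theta>s n)" for n
  define k where "k n = exp (- (\<epsilon> n * A (\<theta>s n)))" for n
  have a_eq: "\<epsilon> n * \<theta>s n = a n" for n using q_pos[of n] by (simp add: a_def field_simps)
  have a_lim: "a \<longlonglongrightarrow> 0" unfolding a_def using tendsto_diff[OF \<theta>s_lim tendsto_const[of \<theta>0]] by simp
  have near0: "\<bar>\<theta>0 - \<theta>0\<bar> < \<rho>" using \<rho>_pos by simp
  have c_lim: "c \<longlonglongrightarrow> mean"
    unfolding c_def A1_\<theta>0[symmetric] by (rule isCont_tendsto_compose[OF isCont_A1[OF near0] \<theta>s_lim])
  have A2_lim: "(\<lambda>n. A2 (\<theta>s n)) \<longlonglongrightarrow> var"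
    unfolding A2_\<theta>0[symmetric] by (rule isCont_tendsto_compose[OF isCont_A2[OF near0] \<theta>s_lim])
  have \<epsilon>_lim0: "\<epsilon> \<longlonglongrightarrow> 0" using tendsto_diff[OF tendsto_const[of 1] q_lim] by simp
  have "(\<lambda>n. A (\<theta>s n)) \<longlonglongrightarrow> A \<theta>0"
    by (rule isCont_tendsto_compose[OF DERIV_isCont[OF DERIV_A[OF near0]] \<theta>s_lim])
  then have "k \<longlonglongrightarrow> exp (- (0 * A \<theta>0))"
    unfolding k_def by (intro tendsto_intros \<epsilon>_lim0)
  then have k_lim: "k \<longlonglongrightarrow> 1" by simp
  have m_lim: "(\<lambda>n. mom j (x n)) \<longlonglongrightarrow> mom j 0" if "x \<longlonglongrightarrow> 0" for x j
    by (rule isCont_tendsto_compose[OF isCont_mom_0 that])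
  have small: "\<forall>\<^sub>F n in sequentially. \<bar>a n\<bar> < \<rho> / 2"
    using tendstoD[OF a_lim, of "\<rho> / 2"] \<rho>_pos by (simp add: dist_real_def)
  have e: "exp (\<epsilon> n * (\<theta>s n * y - A (\<theta>s n))) = k n * exp (a n * y)" for n y
  proof -
    have "\<epsilon> n * (\<theta>s n * y - A (\<theta>s n)) = (\<epsilon> n * \<theta>s n) * y - \<epsilon> n * A (\<theta>s n)"
      by (simp only: right_diff_distrib mult.assoc)
    then show ?thesis unfolding a_eq k_def exp_add[symmetric] by simp
  qed
  have quad: "(y - c n)\<^sup>2 = (c n)\<^sup>2 + (- 2 * c n) * y + 1 * y\<^sup>2" for n y
    by (simp add: power2_diff)
  have "\<forall>\<^sub>F n in sequentially. score_variance n =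
      (k n)\<^sup>2 * ((c n)\<^sup>2 * mom 0 (2 * a n) + (- 2 * c n) * mom 1 (2 * a n) + 1 * mom 2 (2 * a n))"
    using small
  proof eventually_elim
    case (elim n)
    have "(exp (\<epsilon> n * (\<theta>s n * y - A (\<theta>s n))) * (y - A1 (\<theta>s n)))\<^sup>2 =
        (k n)\<^sup>2 * (((c n)\<^sup>2 + (- 2 * c n) * y + 1 * y\<^sup>2) * exp ((2 * a n) * y))" for y
      unfolding e c_def[symmetric] power_mult_distrib quad
      by (simp add: power2_eq_square exp_add[symmetric])
    then show ?case
      using elim expectation_quadratic_tilted(2)[of "2 * a n" "(c n)\<^sup>2" "- 2 * c n" 1]
      unfolding score_variance_def by simp
  qed
  moreover have "(\<lambda>n. (k n)\<^sup>2 * ((c n)\<^sup>2 * mom 0 (2 * a n) + (- 2 * c n) * mom 1 (2 * a n) + 1 * mom 2 (2 * a n)))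
      \<longlonglongrightarrow> 1\<^sup>2 * (mean\<^sup>2 * mom 0 0 + (- 2 * mean) * mom 1 0 + 1 * mom 2 0)"
    by (intro tendsto_intros k_lim c_lim m_lim tendsto_mult_right_zero a_lim)
  ultimately have v: "score_variance \<longlonglongrightarrow> var"
    by (simp add: tendsto_cong var_eq mom_at_0(1,2) power2_eq_square)
  have "\<forall>\<^sub>F n in sequentially. score_slope n = k n *
      ((\<epsilon> n * (c n)\<^sup>2 - A2 (\<theta>s n)) * mom 0 (a n) + (\<epsilon> n * (- 2 * c n)) * mom 1 (a n) + \<epsilon> n * mom 2 (a n))"
    using small
  proof eventually_elim
    case (elim n)
    have "exp (\<epsilon> n * (\<theta>s n * y - A (\<theta>s n))) * (\<epsilon> n * (y - A1 (\<theta>s n))\<^sup>2 - A2 (\<theta>s n)) =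
        k n * (((\<epsilon> n * (c n)\<^sup>2 - A2 (\<theta>s n)) + (\<epsilon> n * (- 2 * c n)) * y + \<epsilon> n * y\<^sup>2) * exp (a n * y))" for y
      unfolding e c_def[symmetric] quad by (simp add: algebra_simps)
    then show ?case
      using elim \<rho>_pos expectation_quadratic_tilted(2)[of "a n" "\<epsilon> n * (c n)\<^sup>2 - A2 (\<theta>s n)" "\<epsilon> n * (- 2 * c n)" "\<epsilon> n"]
      unfolding score_slope_def by simp
  qed
  moreover have "(\<lambda>n. k n *
      ((\<epsilon> n * (c n)\<^sup>2 - A2 (\<theta>s n)) * mom 0 (a n) + (\<epsilon> n * (- 2 * c n)) * mom 1 (a n) + \<epsilon> n * mom 2 (a n)))
      \<longlonglongrightarrow> 1 * ((0 * mean\<^sup>2 - var) * mom 0 0 + (0 * (- 2 * mean)) * mom 1 0 + 0 * mom 2 0)"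
    by (intro tendsto_add tendsto_mult tendsto_diff tendsto_power tendsto_const k_lim c_lim m_lim a_lim \<epsilon>_lim0 A2_lim)
  ultimately have s: "score_slope \<longlonglongrightarrow> - var"
    by (simp add: tendsto_cong mom_at_0(1))
  have "(\<lambda>n. - sqrt (score_variance n) / score_slope n) \<longlonglongrightarrow> - sqrt var / - var"
    using var_pos by (intro tendsto_divide tendsto_minus tendsto_real_sqrt v s) auto
  moreover have "- sqrt var / - var = 1 / sqrt var"
    using var_pos by (simp add: real_div_sqrt field_simps)
  ultimately show ?thesis by simp
qed

text \<open>
  By tightness, the estimator may be assumed to lie within \<open>\<delta> / sqrt n\<close> of the surrogate parameter for a fixed
  \<open>\<delta>\<close>. The Taylor remainder is then controlled by the supremum of \<open>\<bar>\<alpha>''\<bar>\<close> over this window.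
\<close>

theorem delta_method:
  fixes \<alpha> \<alpha>' \<alpha>'' :: "nat \<Rightarrow> real \<Rightarrow> real"
  assumes \<sigma>: "\<sigma> \<longlonglongrightarrow> 1 / sqrt var"
    and d1: "\<And>n t. \<bar>t - \<theta>0\<bar> < \<rho> \<Longrightarrow> (\<alpha> n has_real_derivative \<alpha>' n t) (at t)"
    and d2: "\<And>n t. \<bar>t - \<theta>0\<bar> < \<rho> \<Longrightarrow> (\<alpha>' n has_real_derivative \<alpha>'' n t) (at t)"
    and cont: "\<And>n t. \<bar>t - \<theta>0\<bar> < \<rho> \<Longrightarrow> isCont (\<alpha>'' n) t"
    and nz1: "\<forall>\<^sub>F n in sequentially. \<alpha>' n (\<theta>s n) \<noteq> 0"
    and nz2: "\<forall>\<^sub>F n in sequentially. \<alpha>'' n (\<theta>s n) \<noteq> 0"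
    and rate: "\<And>\<delta>. \<delta> > 0 \<Longrightarrow>
      (\<lambda>n. real n powr (- 1 / 2) * \<bar>\<alpha>'' n (\<theta>s n) / \<alpha>' n (\<theta>s n)\<bar> *
        (SUP t\<in>\<Theta> \<inter> {\<theta>s n - \<delta> / sqrt (real n) .. \<theta>s n + \<delta> / sqrt (real n)}.
          \<bar>\<alpha>'' n t / \<alpha>'' n (\<theta>s n)\<bar>)) \<longlonglongrightarrow> 0"
  shows "((\<lambda>p. sqrt (real (fst p)) * ((\<alpha> (fst p) (\<theta>t (fst p) (snd p)) - \<alpha> (fst p) (\<theta>s (fst p))) /
      (\<sigma> (fst p) * \<alpha>' (fst p) (\<theta>s (fst p)))) - std_sum (fst p) (snd p)) \<longlongrightarrow> 0) (in_prob M)"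
proof -
  define Z where "Z n \<omega> = sqrt (real n) * (\<theta>t n \<omega> - \<theta>s n) / \<sigma> n" for n \<omega>
  define T where "T n \<omega> = sqrt (real n) * ((\<alpha> n (\<theta>t n \<omega>) - \<alpha> n (\<theta>s n)) / (\<sigma> n * \<alpha>' n (\<theta>s n)))" for n \<omega>
  have ZS: "((\<lambda>p. Z (fst p) (snd p) - std_sum (fst p) (snd p)) \<longlongrightarrow> 0) (in_prob M)"
    unfolding Z_def by (rule estimator_asymptotically_linear[OF \<sigma>])
  have tight: "tight_rvs M Z" by (rule tight_rvs_cong_in_prob[OF tight_std_sum ZS])
  \<comment> \<open>The limit of \<open>\<sigma>\<close>; eventually \<open>\<sigma> n\<close> lies between \<open>c / 2\<close> and \<open>2 * c\<close>.\<close>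
  define c where "c = 1 / sqrt var"
  have c: "0 < c" using var_pos by (simp add: c_def)
  have \<sigma>1: "\<forall>\<^sub>F n in sequentially. c / 2 < \<sigma> n" "\<forall>\<^sub>F n in sequentially. \<sigma> n < 2 * c"
    using order_tendstoD(1)[OF \<sigma>, of "c / 2"] order_tendstoD(2)[OF \<sigma>, of "2 * c"] c
    unfolding c_def[symmetric] by simp_all
  have "((\<lambda>p. T (fst p) (snd p) - Z (fst p) (snd p)) \<longlongrightarrow> 0) (in_prob M)"
  proof (rule tendstoI)
    fix e :: real assume e: "0 < e"
    show "\<forall>\<^sub>F p in in_prob M. dist (T (fst p) (snd p) - Z (fst p) (snd p)) 0 < e"
    proof (rule eventually_in_prob_if_tight[OF tight])
      fix B :: real assume B: "0 < B"
      \<comment> \<open>\<open>\<bar>Z\<bar> \<le> B\<close> and \<open>\<sigma> n < 2 * c\<close> force \<open>sqrt n * \<bar>\<theta>t - \<theta>s\<bar> \<le> \<delta>\<close>.\<close>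
      define \<delta> where "\<delta> = B * (2 * c)"
      have \<delta>: "0 < \<delta>" using B c by (simp add: \<delta>_def)
      let ?rate = "\<lambda>n. real n powr (- 1 / 2) * \<bar>\<alpha>'' n (\<theta>s n) / \<alpha>' n (\<theta>s n)\<bar> *
        (SUP t\<in>\<Theta> \<inter> {\<theta>s n - \<delta> / sqrt (real n) .. \<theta>s n + \<delta> / sqrt (real n)}. \<bar>\<alpha>'' n t / \<alpha>'' n (\<theta>s n)\<bar>)"
      \<comment> \<open>The remainder is at most \<open>\<delta>\<^sup>2 / (2 * \<sigma> n) * ?rate n\<close>, and \<open>2 * \<sigma> n > c\<close>.\<close>
      have r: "\<forall>\<^sub>F n in sequentially. ?rate n < e * c / \<delta>\<^sup>2"
        by (rule order_tendstoD(2)[OF rate[OF \<delta>]]) (use e c \<delta> in simp)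
      have "(\<lambda>n. \<delta> / sqrt (real n)) \<longlonglongrightarrow> 0"
        by (intro tendsto_divide_0[OF tendsto_const] filterlim_at_top_imp_at_infinity
            filterlim_compose[OF sqrt_at_top filterlim_real_sequentially])
      then have w: "\<forall>\<^sub>F n in sequentially. \<delta> / sqrt (real n) < \<rho> / 2"
        by (rule order_tendstoD) (use \<rho>_pos in simp)
      have \<theta>sn: "\<forall>\<^sub>F n in sequentially. dist (\<theta>s n) \<theta>0 < \<rho> / 2"
        by (rule tendstoD[OF \<theta>s_lim]) (use \<rho>_pos in simp)
      show "\<forall>\<^sub>F p in in_prob M. \<bar>Z (fst p) (snd p)\<bar> \<le> B \<longrightarrow> dist (T (fst p) (snd p) - Z (fst p) (snd p)) 0 < e"
        using eventually_fst_in_prob[OF r] eventually_fst_in_prob[OF w] eventually_fst_in_prob[OF \<theta>sn]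
          eventually_fst_in_prob[OF \<sigma>1(1)] eventually_fst_in_prob[OF \<sigma>1(2)]
          eventually_fst_in_prob[OF nz1] eventually_fst_in_prob[OF nz2]
          eventually_fst_in_prob[OF eventually_ge_at_top[of 1]]
      proof eventually_elim
        case (elim p)
        obtain n \<omega> where p: "p = (n, \<omega>)" by force
        note elim = elim[unfolded p fst_conv snd_conv dist_real_def]
        let ?t = "\<theta>t n \<omega>" and ?s = "\<theta>s n" and ?w = "\<delta> / sqrt (real n)"
        have n: "0 < sqrt (real n)" using elim(8) by simp
        have \<sigma>p: "0 < \<sigma> n" using elim(4) c by linarith
        have "\<bar>T n \<omega> - Z n \<omega>\<bar> < e" if Z: "\<bar>Z n \<omega>\<bar> \<le> B"
        proof -
          have "sqrt (real n) * \<bar>?t - ?s\<bar> = \<bar>Z n \<omega>\<bar> * \<sigma> n"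
            using \<sigma>p by (simp add: Z_def abs_mult abs_divide)
          also have "\<dots> \<le> \<delta>" unfolding \<delta>_def using Z elim(5) \<sigma>p B by (intro mult_mono) auto
          finally have ts: "sqrt (real n) * \<bar>?t - ?s\<bar> \<le> \<delta>" .
          then have ts': "\<bar>?t - ?s\<bar> \<le> ?w" using n by (simp add: field_simps)
          have near: "\<bar>u - \<theta>0\<bar> < \<rho>" if "\<bar>u - ?s\<bar> \<le> ?w" for u
            using that elim(2,3) by linarith
          obtain z where z: "\<bar>z - ?s\<bar> \<le> \<bar>?t - ?s\<bar>"
            "\<alpha> n ?t = \<alpha> n ?s + \<alpha>' n ?s * (?t - ?s) + \<alpha>'' n z / 2 * (?t - ?s)\<^sup>2"
            by (rule taylor_order_2[of ?s ?t "\<alpha> n" "\<alpha>' n" "\<alpha>'' n"])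
              (use near ts' in \<open>auto intro!: d1 d2\<close>)
          let ?I = "{?s - ?w .. ?s + ?w}" and ?g = "\<lambda>t. \<bar>\<alpha>'' n t / \<alpha>'' n ?s\<bar>"
          have "compact (?g ` ?I)"
          proof (intro compact_continuous_image compact_Icc continuous_at_imp_continuous_on ballI)
            fix u assume "u \<in> ?I"
            then have "\<bar>u - \<theta>0\<bar> < \<rho>" by (intro near) (auto simp: abs_le_iff)
            from cont[OF this, of n] show "isCont ?g u" using elim(7) by (intro continuous_intros) auto
          qed
          then have bdd: "bdd_above (?g ` (\<Theta> \<inter> ?I))"
            by (meson bdd_above_mono bounded_imp_bdd_above compact_imp_bounded image_mono inf_le2)
          have zI: "z \<in> \<Theta> \<inter> ?I"
          proof -
            have "\<bar>z - ?s\<bar> \<le> ?w" using z(1) ts' by linarith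
            then show ?thesis using near_in_params[OF near] by (auto simp: abs_le_iff)
          qed
          have "?g z \<le> (SUP t\<in>\<Theta> \<inter> ?I. ?g t)" by (rule cSUP_upper[OF zI bdd])
          then have "real n powr (- 1 / 2) * \<bar>\<alpha>'' n ?s / \<alpha>' n ?s\<bar> * ?g z \<le> ?rate n"
            by (intro mult_left_mono) auto
          also have "\<dots> < e * c / \<delta>\<^sup>2" by (rule elim(1))
          also have "real n powr (- 1 / 2) * \<bar>\<alpha>'' n ?s / \<alpha>' n ?s\<bar> * ?g z =
              real n powr (- 1 / 2) * \<bar>\<alpha>'' n z / \<alpha>' n ?s\<bar>"
            using elim(7) by (simp add: abs_divide)
          also have "real n powr (- 1 / 2) = 1 / sqrt (real n)"
            using powr_minus_divide[of "real n" "1 / 2"] powr_half_sqrt[of "real n"] by simp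
          finally have g: "1 / sqrt (real n) * \<bar>\<alpha>'' n z / \<alpha>' n ?s\<bar> < e * c / \<delta>\<^sup>2" .
          have "T n \<omega> - Z n \<omega> = sqrt (real n) * (?t - ?s)\<^sup>2 * (\<alpha>'' n z / \<alpha>' n ?s) / (2 * \<sigma> n)"
            unfolding T_def Z_def z(2) using elim(6) \<sigma>p by (simp add: field_simps)
          also have "\<dots> = (sqrt (real n) * \<bar>?t - ?s\<bar>)\<^sup>2 * (1 / sqrt (real n) * (\<alpha>'' n z / \<alpha>' n ?s)) / (2 * \<sigma> n)"
            using n by (simp add: power_mult_distrib power2_eq_square[of "sqrt (real n)"] del: real_sqrt_mult_self)
          finally have "\<bar>T n \<omega> - Z n \<omega>\<bar> = (sqrt (real n) * \<bar>?t - ?s\<bar>)\<^sup>2 *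
              (1 / sqrt (real n) * \<bar>\<alpha>'' n z / \<alpha>' n ?s\<bar>) / (2 * \<sigma> n)"
            using n \<sigma>p by (simp add: abs_mult abs_divide)
          also have "\<dots> \<le> (\<delta>\<^sup>2 * (1 / sqrt (real n) * \<bar>\<alpha>'' n z / \<alpha>' n ?s\<bar>)) / (2 * \<sigma> n)"
            using ts n \<sigma>p by (intro divide_right_mono mult_right_mono power_mono) auto
          also have "\<dots> \<le> (\<delta>\<^sup>2 * (1 / sqrt (real n) * \<bar>\<alpha>'' n z / \<alpha>' n ?s\<bar>)) / c"
            using elim(4) c n by (intro divide_left_mono) auto
          also have "\<dots> < (\<delta>\<^sup>2 * (e * c / \<delta>\<^sup>2)) / c"
            using g c \<delta> by (intro divide_strict_right_mono mult_strict_left_mono) auto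
          also have "\<dots> = e" using c \<delta> by simp
          finally show ?thesis .
        qed
        then show ?case by (simp add: p dist_real_def)
      qed
    qed
  qed
  from tendsto_add[OF this ZS]
  have "((\<lambda>p. T (fst p) (snd p) - std_sum (fst p) (snd p)) \<longlongrightarrow> 0) (in_prob M)" by simp
  then show ?thesis unfolding T_def .
qed

end

section \<open>Tail probabilities of an exponential family\<close>

lemma full_rank_exp_familyD:
  assumes "full_rank_exp_family \<mu> b \<Theta>"
  shows "sigma_finite_measure \<mu>" "sets \<mu> = sets borel" "b \<in> borel_measurable \<mu>"
    "t \<in> \<Theta> \<Longrightarrow> integrable \<mu> (\<lambda>x. exp (t * b x))" "\<not> (AE x in \<mu>. b x = c)"
  using assms by (auto simp: full_rank_exp_family_def)

text \<open>
  The normaliser vanishes only if \<open>\<mu>\<close> is the null measure, for which \<open>b\<close> is constant almost everywhere.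
\<close>

lemma normaliser_pos:
  assumes family: "full_rank_exp_family \<mu> b \<Theta>" and t: "t \<in> \<Theta>"
  shows "0 < (LINT x|\<mu>. exp (t * b x))"
proof -
  have "(LINT x|\<mu>. exp (t * b x)) \<noteq> 0"
  proof
    assume "(LINT x|\<mu>. exp (t * b x)) = 0"
    then have "AE x in \<mu>. exp (t * b x) = 0"
      using integral_nonneg_eq_0_iff_AE[OF full_rank_exp_familyD(4)[OF family t]] by simp
    then have "AE x in \<mu>. b x = 0" by (rule eventually_mono) simp
    then show False using full_rank_exp_familyD(5)[OF family] by blast
  qed
  moreover have "0 \<le> (LINT x|\<mu>. exp (t * b x))" by (rule Bochner_Integration.integral_nonneg) simp
  ultimately show ?thesis by (metis order_le_less)
qed

lemma ef_density_eq:
  assumes "full_rank_exp_family \<mu> b \<Theta>" "t \<in> \<Theta>"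
  shows "ef_density \<mu> b x t = exp (t * b x) / (LINT x|\<mu>. exp (t * b x))"
  using normaliser_pos[OF assms] by (simp add: ef_density_def log_partition_def exp_diff)

lemma ef_density_measurable:
  "b \<in> borel_measurable \<mu> \<Longrightarrow> (\<lambda>x. ef_density \<mu> b x t) \<in> borel_measurable \<mu>"
  unfolding ef_density_def
  by (rule measurable_compose[OF _ borel_measurable_exp]) simp

lemma tail_eq_ratio:
  assumes family: "full_rank_exp_family \<mu> b \<Theta>" and t: "t \<in> \<Theta>"
  shows "tail \<mu> b x t = 1 - exp_moment \<mu> (indicator {..x}) b 0 t / exp_moment \<mu> (\<lambda>_. 1) b 0 t"
proof -
  note [measurable] = full_rank_exp_familyD(3)[OF family]
    ef_density_measurable[OF full_rank_exp_familyD(3)[OF family]]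
  have [measurable]: "{..x} \<in> sets \<mu>" using full_rank_exp_familyD(2)[OF family] by simp
  have "measure (ef_law \<mu> b t) {..x} = integral\<^sup>L (ef_law \<mu> b t) (indicator {..x})"
    by (simp add: ef_law_def)
  also have "\<dots> = (LINT y|\<mu>. ef_density \<mu> b y t * indicator {..x} y)"
    unfolding ef_law_def by (subst integral_real_density) (auto simp: ef_density_def)
  also have "\<dots> = (LINT y|\<mu>. indicator {..x} y * exp (t * b y) / (LINT x|\<mu>. exp (t * b x)))"
    by (simp add: ef_density_eq[OF family t] mult.commute)
  finally show ?thesis by (simp add: tail_def exp_moment_def)
qed

text \<open>
  In the interior of \<open>\<Theta>\<close> the tail is one minus a quotient of exponential moments, hence smooth. This also
  identifies \<open>tail_d1\<close> and \<open>tail_d2\<close>, given by \<open>deriv\<close>, as actual derivatives.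
\<close>

lemma tail_C2:
  assumes family: "full_rank_exp_family \<mu> b \<Theta>"
    and near: "\<And>t. \<bar>t - \<theta>0\<bar> < r \<Longrightarrow> t \<in> \<Theta>" and t: "\<bar>t - \<theta>0\<bar> < r"
  shows "(tail \<mu> b x has_real_derivative tail_d1 \<mu> b x t) (at t)"
    and "(tail_d1 \<mu> b x has_real_derivative tail_d2 \<mu> b x t) (at t)"
    and "isCont (tail_d2 \<mu> b x) t"
proof -
  note [measurable] = full_rank_exp_familyD(3)[OF family]
  have [measurable]: "{..x} \<in> sets \<mu>" using full_rank_exp_familyD(2)[OF family] by simp
  interpret F: exp_moments \<mu> b "indicator {..x}" \<theta>0 r
    by unfold_locales (auto intro!: full_rank_exp_familyD(4)[OF family] near simp: indicator_def)
  interpret Z: exp_moments \<mu> b "\<lambda>_. 1" \<theta>0 r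
    by unfold_locales (auto intro!: full_rank_exp_familyD(4)[OF family] near)
  let ?F = "exp_moment \<mu> (indicator {..x}) b" and ?Z = "exp_moment \<mu> (\<lambda>_. 1) b"
  let ?S = "{t. \<bar>t - \<theta>0\<bar> < r}"
  define G1 where "G1 t = - (?F 1 t * ?Z 0 t - ?F 0 t * ?Z 1 t) / (?Z 0 t * ?Z 0 t)" for t
  define G2 where "G2 t = - ((?F 2 t * ?Z 0 t - ?F 0 t * ?Z 2 t) * (?Z 0 t * ?Z 0 t) -
    (?F 1 t * ?Z 0 t - ?F 0 t * ?Z 1 t) * (2 * ?Z 0 t * ?Z 1 t)) / ((?Z 0 t * ?Z 0 t) * (?Z 0 t * ?Z 0 t))" for t
  have S: "open ?S" by (intro open_Collect_less continuous_intros)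
  have pos: "?Z 0 u \<noteq> 0" if "\<bar>u - \<theta>0\<bar> < r" for u
    using normaliser_pos[OF family near[OF that]] by (simp add: exp_moment_def)
  note dF = F.DERIV_exp_moment and dZ = Z.DERIV_exp_moment
  have D1: "(tail \<mu> b x has_real_derivative G1 u) (at u)" if u: "\<bar>u - \<theta>0\<bar> < r" for u
  proof (rule has_field_derivative_transform_within_open[OF _ S])
    show "((\<lambda>t. 1 - ?F 0 t / ?Z 0 t) has_real_derivative G1 u) (at u)"
      using pos[OF u] unfolding G1_def
      by (auto intro!: derivative_eq_intros dF dZ u simp: field_simps)
    show "1 - ?F 0 s / ?Z 0 s = tail \<mu> b x s" if "s \<in> ?S" for s
      using that tail_eq_ratio[OF family near, of s x] by simp
  qed (use u in simp)
  have d1: "tail_d1 \<mu> b x u = G1 u" if "\<bar>u - \<theta>0\<bar> < r" for u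
    using DERIV_imp_deriv[OF D1[OF that]] by (simp add: tail_d1_def)
  have D2: "(tail_d1 \<mu> b x has_real_derivative G2 u) (at u)" if u: "\<bar>u - \<theta>0\<bar> < r" for u
  proof (rule has_field_derivative_transform_within_open[OF _ S])
    show "(G1 has_real_derivative G2 u) (at u)"
      using pos[OF u] unfolding G1_def[abs_def] G2_def
      by (auto intro!: derivative_eq_intros dF dZ u simp: numeral_2_eq_2 algebra_simps)
  qed (use u d1 in auto)
  have d2: "tail_d2 \<mu> b x u = G2 u" if "\<bar>u - \<theta>0\<bar> < r" for u
    using DERIV_imp_deriv[OF D2[OF that]] by (simp add: tail_d2_def)
  show "(tail \<mu> b x has_real_derivative tail_d1 \<mu> b x t) (at t)"
    "(tail_d1 \<mu> b x has_real_derivative tail_d2 \<mu> b x t) (at t)"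
    using D1[OF t] D2[OF t] d1[OF t] d2[OF t] by simp_all
  have "isCont G2 t"
    unfolding G2_def[abs_def] using pos[OF t]
    by (intro continuous_intros F.isCont_exp_moment Z.isCont_exp_moment t) auto
  moreover have "\<forall>\<^sub>F u in nhds t. tail_d2 \<mu> b x u = G2 u"
    using eventually_nhds_in_open[OF S, of t] t by (auto elim!: eventually_mono simp: d2)
  ultimately show "isCont (tail_d2 \<mu> b x) t" by (simp add: isCont_cong)
qed

text \<open>
  Measurability in the parameter follows from Fubini's theorem on the whole line; for parameters where the
  normalising integral diverges the expression has an arbitrary, still measurable value.
\<close>

lemma tail_measurable:
  assumes "sigma_finite_measure \<mu>" "sets \<mu> = sets borel" and [measurable]: "b \<in> borel_measurable \<mu>"
  shows "tail \<mu> b x \<in> borel_measurable borel"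
proof -
  interpret sigma_finite_measure \<mu> by fact
  have [measurable]: "{..x} \<in> sets \<mu>" using assms(2) by simp
  have [measurable]: "log_partition \<mu> b \<in> borel_measurable borel"
    unfolding log_partition_def[abs_def] by measurable
  have "tail \<mu> b x = (\<lambda>t. 1 - enn2real (\<integral>\<^sup>+ y. ennreal (exp (t * b y - log_partition \<mu> b t)) * indicator {..x} y \<partial>\<mu>))"
    unfolding tail_def[abs_def] ef_law_def measure_def ef_density_def
    by (subst emeasure_density) auto
  also have "\<dots> \<in> borel_measurable borel" by measurable
  finally show ?thesis .
qed

section \<open>Asymptotic normality of the plug-in tail probability\<close>

theorem theorem5p1:
  fixes M :: "'a measure" and X :: "nat \<Rightarrow> 'a \<Rightarrow> real"
    and \<mu> :: "real measure" and b :: "real \<Rightarrow> real" and \<Theta> :: "real set" and \<theta>0 :: real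
    and x q \<theta>s :: "nat \<Rightarrow> real" and \<theta>t :: "nat \<Rightarrow> 'a \<Rightarrow> real"
  assumes "prob_space M"
    and family: "full_rank_exp_family \<mu> b \<Theta>"
    and indep: "prob_space.indep_vars M (\<lambda>_. borel) X {1..}"
    and distr: "\<And>i. i \<ge> 1 \<Longrightarrow> distributed M \<mu> (X i) (\<lambda>y. ennreal (ef_density \<mu> b y \<theta>0))"
    and tail_pos: "\<And>y \<theta>. \<theta> \<in> \<Theta> \<Longrightarrow> tail \<mu> b y \<theta> > 0"
    and x_lim: "filterlim x at_top sequentially"
    and A1: "\<And>n. q n > 0" "q \<longlonglongrightarrow> 1"
    and A2: "compact \<Theta>" "\<theta>0 \<in> interior \<Theta>"
    and surrogate: "\<And>n. \<theta>s n = \<theta>0 / q n"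
    and estimator_measurable: "\<And>n. n \<ge> 1 \<Longrightarrow> \<theta>t n \<in> borel_measurable M"
    and estimator: "\<And>n \<omega>. n \<ge> 1 \<Longrightarrow> \<omega> \<in> space M \<Longrightarrow>
          is_MLqE \<mu> b \<Theta> (q n) n (\<lambda>i. X i \<omega>) (\<theta>t n \<omega>)"
    and d1_nonzero: "eventually (\<lambda>n. tail_d1 \<mu> b (x n) (\<theta>s n) \<noteq> 0) sequentially"
    and d2_nonzero: "eventually (\<lambda>n. tail_d2 \<mu> b (x n) (\<theta>s n) \<noteq> 0) sequentially"
    and rate: "\<And>\<delta>. \<delta> > 0 \<Longrightarrow>
          (\<lambda>n. real n powr (- 1 / 2) * \<bar>tail_gamma \<mu> b (x n) (\<theta>s n)\<bar> *
               tail_beta \<mu> b \<Theta> n (x n) (\<theta>s n) \<delta>) \<longlonglongrightarrow> 0"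
  shows "weak_conv_m
           (\<lambda>n. distr M borel
              (\<lambda>\<omega>. sqrt (real n) * ((tail \<mu> b (x n) (\<theta>t n \<omega>) - tail \<mu> b (x n) (\<theta>s n)) /
                     (sigma_MLqE \<mu> b \<theta>0 (\<theta>s n) (q n) * tail_d1 \<mu> b (x n) (\<theta>s n)))))
           std_normal_distribution"
proof -
  interpret prob_space M by fact
  note fam = full_rank_exp_familyD[OF family]
  have b_borel [measurable]: "b \<in> borel_measurable borel"
    using fam(3) measurable_cong_sets[OF fam(2) refl] by blast
  note [measurable] = fam(3) ef_density_measurable[OF fam(3)]
  define L where "L = ef_law \<mu> b \<theta>0"
  define N where "N = distr L borel b"
  define A where "A = log_partition \<mu> b"
  \<comment> \<open>The observations \<open>X 1, \<dots>, X n\<close> become \<open>Y 0, \<dots>, Y (n - 1)\<close>.\<close>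
  define Y where "Y i \<omega> = b (X (Suc i) \<omega>)" for i \<omega>
  have sets_L: "sets L = sets borel" using fam(2) by (simp add: L_def ef_law_def)
  have bL [measurable]: "b \<in> borel_measurable L" using b_borel measurable_cong_sets[OF sets_L refl] by blast
  have \<theta>0: "\<theta>0 \<in> \<Theta>" using A2(2) interior_subset by blast
  have X_law: "distr M borel (X (Suc i)) = L" for i
  proof -
    have "distr M borel (X (Suc i)) = distr M \<mu> (X (Suc i))" using fam(2) by (intro distr_cong) auto
    also have "\<dots> = L" using distributed_distr_eq_density[OF distr] by (simp add: L_def ef_law_def)
    finally show ?thesis .
  qed
  have X_meas [measurable]: "X (Suc i) \<in> borel_measurable M" for i
    using indep by (auto simp: indep_vars_def2)
  have Y_law: "distr M borel (Y i) = N" for i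
  proof -
    have "distr M borel (Y i) = distr (distr M borel (X (Suc i))) borel b"
      by (subst distr_distr) (auto simp: Y_def[abs_def] comp_def)
    then show ?thesis by (simp add: X_law N_def)
  qed
  have Y_indep: "indep_vars (\<lambda>_. borel) Y UNIV"
  proof -
    have "indep_vars (\<lambda>_. borel) (\<lambda>i. X (Suc i)) UNIV"
      by (rule indep_vars_reindex[where N = "\<lambda>_. borel"])
        (use indep in \<open>auto intro: indep_vars_subset\<close>)
    then show ?thesis unfolding Y_def[abs_def] by (rule indep_vars_compose2) auto
  qed
  have integral_N: "integral\<^sup>L N g = (LINT y|L. g (b y))"
    and integrable_N: "integrable N g \<longleftrightarrow> integrable L (\<lambda>y. g (b y))"
    if "g \<in> borel_measurable borel" for g :: "real \<Rightarrow> real"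
    using that unfolding N_def by (simp_all add: integral_distr integrable_distr_eq)
  have tilt: "ef_density \<mu> b y \<theta>0 * exp ((t - \<theta>0) * b y) = exp (- A \<theta>0) * exp (t * b y)" for t y
    unfolding ef_density_def A_def exp_add[symmetric] by (simp add: algebra_simps)
  have "iid_sample M Y N" by unfold_locales (fact Y_indep Y_law)+
  then interpret iid_sample M Y N .
  interpret mlqe_sample M Y N A \<Theta> \<theta>0 q \<theta>t
  proof
    fix t assume t: "t \<in> \<Theta>"
    have "integrable L (\<lambda>y. exp ((t - \<theta>0) * b y))"
      unfolding L_def ef_law_def using fam(4)[OF t]
      by (subst integrable_real_density) (auto simp: tilt, auto simp: ef_density_def)
    then show "integrable N (\<lambda>y. exp ((t - \<theta>0) * y))" by (simp add: integrable_N)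
    have "(LINT y|L. exp ((t - \<theta>0) * b y)) = exp (- A \<theta>0) * (LINT y|\<mu>. exp (t * b y))"
      unfolding L_def ef_law_def
      by (subst integral_real_density) (auto simp: tilt, auto simp: ef_density_def)
    also have "(LINT y|\<mu>. exp (t * b y)) = exp (A t)"
      using normaliser_pos[OF family t] by (simp add: A_def log_partition_def)
    finally show "N.expectation (\<lambda>y. exp ((t - \<theta>0) * y)) = exp (A t - A \<theta>0)"
      by (simp add: integral_N exp_add[symmetric])
  next
    show "\<nexists>c. AE y in N. y = c"
    proof
      assume "\<exists>c. AE y in N. y = c"
      then obtain c where "AE y in N. y = c" by blast
      then have "AE y in L. b y = c" unfolding N_def by (simp add: AE_distr_iff)
      then have "AE y in \<mu>. b y = c"
        unfolding L_def ef_law_def by (simp add: AE_density ef_density_def)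
      then show False using fam(5) by blast
    qed
  next
    fix n \<omega> assume "1 \<le> (n::nat)" "\<omega> \<in> space M"
    from estimator[OF this]
    show "is_arg_max (\<lambda>t. \<Sum>i<n. Lq (q n) (exp (t * Y i \<omega> - A t))) (\<lambda>t. t \<in> \<Theta>) (\<theta>t n \<omega>)"
      by (simp add: is_MLqE_def ef_density_def Y_def A_def sum.atLeast1_atMost_eq)
  qed (fact A1 A2)+
  have \<theta>s: "\<theta>s = (\<lambda>n. \<theta>0 / q n)" using surrogate by auto
  define \<sigma> where "\<sigma> n = sigma_MLqE \<mu> b \<theta>0 (\<theta>s n) (q n)" for n
  have Ustar: "Ustar \<mu> b y t p = exp ((1 - p) * (t * b y - A t)) * (b y - A1 t)"
    if "\<bar>t - \<theta>0\<bar> < \<rho>" for y t p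
  proof -
    have "((\<lambda>t. t * b y - A t) has_real_derivative (b y - A1 t)) (at t)"
      by (auto intro!: derivative_eq_intros DERIV_A that)
    then have "deriv (\<lambda>t. ln (ef_density \<mu> b y t)) t = b y - A1 t"
      unfolding ef_density_def ln_exp A_def[symmetric] by (rule DERIV_imp_deriv)
    then show ?thesis
      by (simp add: Ustar_def) (simp add: ef_density_def A_def exp_powr_real mult.commute)
  qed
  have dUstar: "deriv (\<lambda>t. Ustar \<mu> b y t p) t =
      exp ((1 - p) * (t * b y - A t)) * ((1 - p) * (b y - A1 t)\<^sup>2 - A2 t)"
    if t: "\<bar>t - \<theta>0\<bar> < \<rho>" for y t p
  proof (rule DERIV_imp_deriv, rule has_field_derivative_transform_within_open[OF _ near_open])
    show "((\<lambda>t. exp ((1 - p) * (t * b y - A t)) * (b y - A1 t)) has_real_derivative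
      exp ((1 - p) * (t * b y - A t)) * ((1 - p) * (b y - A1 t)\<^sup>2 - A2 t)) (at t)"
      by (auto intro!: derivative_eq_intros DERIV_A DERIV_A1 t simp: power2_eq_square algebra_simps)
  qed (use t Ustar in auto)
  have "\<forall>\<^sub>F n in sequentially. \<bar>\<theta>s n - \<theta>0\<bar> < \<rho>"
    using tendstoD[OF \<theta>s_lim \<rho>_pos] by (simp add: \<theta>s dist_real_def)
  then have "\<forall>\<^sub>F n in sequentially. \<sigma> n = - sqrt (score_variance n) / score_slope n"
  proof eventually_elim
    case (elim n)
    then show ?case
      unfolding \<sigma>_def sigma_MLqE_def score_variance_def score_slope_def
      by (subst (1 2) integral_N) (simp_all add: Ustar dUstar L_def[symmetric] \<theta>s)
  qed
  then have \<sigma>_lim: "\<sigma> \<longlonglongrightarrow> 1 / sqrt var"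
    using asymptotic_scale by (simp add: tendsto_cong)
  let ?T = "\<lambda>n \<omega>. sqrt (real n) * ((tail \<mu> b (x n) (\<theta>t n \<omega>) - tail \<mu> b (x n) (\<theta>s n)) /
                     (\<sigma> n * tail_d1 \<mu> b (x n) (\<theta>s n)))"
  have "((\<lambda>p. ?T (fst p) (snd p) - std_sum (fst p) (snd p)) \<longlongrightarrow> 0) (in_prob M)"
    unfolding \<theta>s
  proof (rule delta_method[where \<alpha> = "\<lambda>n. tail \<mu> b (x n)" and \<alpha>' = "\<lambda>n. tail_d1 \<mu> b (x n)"
        and \<alpha>'' = "\<lambda>n. tail_d2 \<mu> b (x n)", OF \<sigma>_lim])
    fix n t assume t: "\<bar>t - \<theta>0\<bar> < \<rho>"
    note tail_C2[OF family near_in_params t, where x = "x n"]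
    then show "(tail \<mu> b (x n) has_real_derivative tail_d1 \<mu> b (x n) t) (at t)"
      "(tail_d1 \<mu> b (x n) has_real_derivative tail_d2 \<mu> b (x n) t) (at t)"
      "isCont (tail_d2 \<mu> b (x n)) t" by blast+
  next
    fix \<delta> :: real assume "0 < \<delta>"
    from rate[OF this] show "(\<lambda>n. real n powr (- 1 / 2) *
        \<bar>tail_d2 \<mu> b (x n) (\<theta>0 / q n) / tail_d1 \<mu> b (x n) (\<theta>0 / q n)\<bar> *
        (SUP t\<in>\<Theta> \<inter> {\<theta>0 / q n - \<delta> / sqrt (real n)..\<theta>0 / q n + \<delta> / sqrt (real n)}.
          \<bar>tail_d2 \<mu> b (x n) t / tail_d2 \<mu> b (x n) (\<theta>0 / q n)\<bar>)) \<longlonglongrightarrow> 0"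
      unfolding \<theta>s tail_gamma_def tail_beta_def .
  qed (use d1_nonzero d2_nonzero in \<open>simp_all add: \<theta>s\<close>)
  moreover have "?T n \<in> borel_measurable M" for n
  \<comment> \<open>For \<open>n = 0\<close> the estimator is arbitrary, but the factor \<open>sqrt 0\<close> annihilates it.\<close>
  proof (cases "n = 0")
    case False
    then have "\<theta>t n \<in> borel_measurable M" by (intro estimator_measurable) simp
    then have "(\<lambda>\<omega>. tail \<mu> b (x n) (\<theta>t n \<omega>)) \<in> borel_measurable M"
      by (rule measurable_compose[OF _ tail_measurable[OF fam(1-3)]])
    then show ?thesis
      by (intro borel_measurable_times borel_measurable_divide borel_measurable_diff borel_measurable_const)
  qed simp
  moreover have "std_sum n \<in> borel_measurable M" for n
    unfolding std_sum_def[abs_def] by measurable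
  ultimately have "weak_conv_m (\<lambda>n. distr M borel (?T n)) std_normal_distribution"
    by (intro slutsky[OF _ _ std_sum_clt real_dist_normal_dist])
  then show ?thesis by (simp only: \<sigma>_def)
qed

end
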